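(* Let $\mathcal{K}\subset\mathbb{R}^d$ be convex and compact with diameter $D_{\mathcal{K}}>0$, let $f$ be convex and $\beta$-smooth over $\mathcal{K}$, accessed through a stochastic gradient oracle with stochastic gradients bounded in norm by $G>0$, and assume that $f,\mathcal{K}$ satisfy the quadratic growth property with parameter $\alpha>0$. Run the stochastic Frank-Wolfe algorithm with nearest extreme point oracle (described in the context) with step-sizes $\eta_t=\frac{2}{t+1}$ and mini-batch sizes satisfying, for all $t\ge1$, $$m_t\ge\max\left\{\left(\frac{G(t+1)}{\beta D_{\mathcal{K}}}\right)^2,\ \min\left\{\left(\frac{GD_{\mathcal{K}}(t+1)}{\beta{D^*}^2}\right)^2,\left(\frac{\alpha G(t+1)^2}{8\beta^2D_{\mathcal{K}}}\right)^2\right\}\right\}$$ (the first term in the inner minimum being $+\infty$ if $D^*=0$). Then $$\forall t\ge2:\quad\mathbb{E}[f(\mathbf{x}_t)-f^*]\le\frac{4\beta{D^*}^2}{t+1}+\frac{\frac{32\beta^2}{\alpha}D_{\mathcal{K}}^2\log(t)}{t^2}.$$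
   Context: $\|\cdot\|$ is the Euclidean norm; $D_{\mathcal{K}}$ is the Euclidean diameter of $\mathcal{K}$ and $\mathcal{V}$ its set of extreme points. $\beta$-smooth over $\mathcal{K}$: $f$ is differentiable on a neighbourhood of $\mathcal{K}$ and $\|\nabla f(\mathbf{x})-\nabla f(\mathbf{y})\|\le\beta\|\mathbf{x}-\mathbf{y}\|$ for all $\mathbf{x},\mathbf{y}\in\mathcal{K}$ ($\beta>0$). $f^*=\min_{\mathcal{K}}f$, $\mathcal{X}^*=\arg\min_{\mathbf{x}\in\mathcal{K}}f(\mathbf{x})$. Quadratic growth with parameter $\alpha>0$: $\mathrm{dist}(\mathbf{x},\mathcal{X}^* )^2\le2\alpha^{-1}(f(\mathbf{x})-f^* )$ for all $\mathbf{x}\in\mathcal{K}$. $S^*\in\arg\min_{S\subseteq\mathcal{V}}\{\max_{\mathbf{u},\mathbf{v}\in S}\|\mathbf{v}-\mathbf{u}\| : \mathcal{X}^*\subseteq\mathrm{conv}(S)\}$ (minima and maxima assumed attained) and $D^*=\max_{\mathbf{u},\mathbf{v}\in S^*}\|\mathbf{v}-\mathbf{u}\|$. Stochastic oracle: for any query $\mathbf{x}\in\mathcal{K}$ it returns a fresh random vector (independent of the past given $\mathbf{x}$) with expectation $\nabla f(\mathbf{x})$ and Euclidean norm at most $G$. Stochastic Frank-Wolfe with nearest extreme point oracle, with step-sizes $\{\eta_t\}\subset[0,1]$ and mini-batch sizes $\{m_t\}\subset\mathbb{N}$: $\mathbf{x}_1\in\mathcal{V}$ is arbitrary; for $t=1,2,\dots$: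 compute $\tilde\nabla_t$ as the average of $m_t$ i.i.d. stochastic gradients at $\mathbf{x}_t$ (unbiased estimators of $\nabla f(\mathbf{x}_t)$); compute $\mathbf{v}_t\in\arg\min_{\mathbf{v}\in\mathcal{V}}\mathbf{v}^\top\tilde\nabla_t+\frac{\beta\eta_t}{2}\|\mathbf{x}_t-\mathbf{v}\|^2$ (a minimizer is assumed to exist); set $\mathbf{x}_{t+1}=(1-\eta_t)\mathbf{x}_t+\eta_t\mathbf{v}_t$. *)

theory Defs
  imports "HOL-Probability.Probability"
begin

section \<open>Convex optimisation\<close>

definition gradient :: "('a::real_inner \<Rightarrow> real) \<Rightarrow> 'a \<Rightarrow> 'a" where
  "gradient f x = (THE D. GDERIV f x :> D)"

definition smooth_over :: "real \<Rightarrow> ('a::real_inner \<Rightarrow> real) \<Rightarrow> 'a set \<Rightarrow> bool" where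
  "smooth_over \<beta> f K \<longleftrightarrow>
     (\<exists>U. open U \<and> K \<subseteq> U \<and> f differentiable_on U) \<and>
     (\<forall>x\<in>K. \<forall>y\<in>K. norm (gradient f x - gradient f y) \<le> \<beta> * norm (x - y))"

definition extreme_points :: "'a::real_vector set \<Rightarrow> 'a set" where
  "extreme_points K = {x. x extreme_point_of K}"

text \<open>The infimum is attained whenever \<open>K\<close> is compact and nonempty and \<open>f\<close> is continuous on \<open>K\<close>.\<close>

definition min_value :: "('a \<Rightarrow> real) \<Rightarrow> 'a set \<Rightarrow> real" where
  "min_value f K = (INF x\<in>K. f x)"

definition minimizers :: "('a \<Rightarrow> real) \<Rightarrow> 'a set \<Rightarrow> 'a set" where
  "minimizers f K = {x. is_arg_min f (\<lambda>y. y \<in> K) x}"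

definition quadratic_growth :: "real \<Rightarrow> ('a::metric_space \<Rightarrow> real) \<Rightarrow> 'a set \<Rightarrow> bool" where
  "quadratic_growth \<alpha> f K \<longleftrightarrow>
     (\<forall>x\<in>K. (infdist x (minimizers f K))\<^sup>2 \<le> 2 / \<alpha> * (f x - min_value f K))"

text \<open>
  A set of extreme points of least diameter among those whose convex hull covers all minimizers.
  The library's \<open>diameter\<close> is a supremum; the second conjunct states that for \<open>S\<close> it is a maximum.
\<close>

definition optimal_hull_set :: "('a::real_normed_vector \<Rightarrow> real) \<Rightarrow> 'a set \<Rightarrow> 'a set \<Rightarrow> bool" where
  "optimal_hull_set f K S \<longleftrightarrow>
     is_arg_min diameter
       (\<lambda>T. T \<subseteq> extreme_points K \<and> minimizers f K \<subseteq> convex hull T) S \<and>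
     (\<exists>u\<in>S. \<exists>w\<in>S. norm (w - u) = diameter S)"

section \<open>Stochastic gradient oracle\<close>

text \<open>
  The oracle is a Markov kernel: \<open>Q x\<close> is the law of the random vector returned for the query \<open>x\<close>.
  Freshness of the returned vectors is part of the description of the algorithm below.
\<close>

definition stochastic_oracle ::
    "real \<Rightarrow> ('a::euclidean_space \<Rightarrow> real) \<Rightarrow> 'a set \<Rightarrow> ('a \<Rightarrow> 'a measure) \<Rightarrow> bool" where
  "stochastic_oracle G f K Q \<longleftrightarrow>
     Q \<in> measurable (restrict_space borel K) (prob_algebra borel) \<and>
     (\<forall>x\<in>K. (AE y in Q x. norm y \<le> G) \<and> (\<integral>y. y \<partial>Q x) = gradient f x)"

section \<open>Stochastic Frank-Wolfe with nearest extreme point oracle\<close>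

text \<open>
  The events determined by everything observed before the gradient queries of iteration \<open>t\<close>. The
  iterates \<open>x 1, \<dots>, x t\<close> are not listed since they are functions of the (deterministic) starting
  point and of \<open>v 1, \<dots>, v (t - 1)\<close>; the latter are listed since ties in the choice of \<open>v s\<close>
  may be broken using additional randomness.
\<close>

definition history ::
    "'w measure \<Rightarrow> (nat \<Rightarrow> nat) \<Rightarrow> (nat \<Rightarrow> nat \<Rightarrow> 'w \<Rightarrow> 'a::topological_space) \<Rightarrow>
     (nat \<Rightarrow> 'w \<Rightarrow> 'a) \<Rightarrow> nat \<Rightarrow> 'w set set" where
  "history M m g v t = sigma_sets (space M)
     ({g s i -` B \<inter> space M | s i B. 1 \<le> s \<and> s < t \<and> i < m s \<and> B \<in> sets borel} \<union>
      {v s -` B \<inter> space M | s B. 1 \<le> s \<and> s < t \<and> B \<in> sets borel})"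

text \<open>
  Conditionally on the history, the vectors \<open>g t i\<close> for \<open>i < m t\<close> are independent with
  common law \<open>Q (x t)\<close>.
\<close>

definition fresh_batch ::
    "'w measure \<Rightarrow> ('a \<Rightarrow> 'a measure) \<Rightarrow> (nat \<Rightarrow> nat) \<Rightarrow> (nat \<Rightarrow> 'w \<Rightarrow> 'a::euclidean_space) \<Rightarrow>
     (nat \<Rightarrow> nat \<Rightarrow> 'w \<Rightarrow> 'a) \<Rightarrow> (nat \<Rightarrow> 'w \<Rightarrow> 'a) \<Rightarrow> nat \<Rightarrow> bool" where
  "fresh_batch M Q m x g v t \<longleftrightarrow>
     (\<forall>A \<in> history M m g v t. \<forall>B. (\<forall>i < m t. B i \<in> sets borel) \<longrightarrow>
        measure M (A \<inter> {\<omega> \<in> space M. \<forall>i < m t. g t i \<omega> \<in> B i}) =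
        (\<integral>\<omega>. indicator A \<omega> * (\<Prod>i < m t. measure (Q (x t \<omega>)) (B i)) \<partial>M))"

definition batch_mean ::
    "(nat \<Rightarrow> nat) \<Rightarrow> (nat \<Rightarrow> nat \<Rightarrow> 'w \<Rightarrow> 'a::real_vector) \<Rightarrow> nat \<Rightarrow> 'w \<Rightarrow> 'a" where
  "batch_mean m g t \<omega> = (1 / real (m t)) *\<^sub>R (\<Sum>i < m t. g t i \<omega>)"

text \<open>
  Rounds are numbered from 1; the values of the sequences at index 0 are irrelevant.
\<close>

definition stochastic_nep_frank_wolfe ::
    "'w measure \<Rightarrow> 'a::euclidean_space set \<Rightarrow> real \<Rightarrow> ('a \<Rightarrow> 'a measure) \<Rightarrow> (nat \<Rightarrow> real) \<Rightarrow>
     (nat \<Rightarrow> nat) \<Rightarrow> (nat \<Rightarrow> 'w \<Rightarrow> 'a) \<Rightarrow> (nat \<Rightarrow> nat \<Rightarrow> 'w \<Rightarrow> 'a) \<Rightarrow> (nat \<Rightarrow> 'w \<Rightarrow> 'a) \<Rightarrow> bool" where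
  "stochastic_nep_frank_wolfe M K \<beta> Q \<eta> m x g v \<longleftrightarrow>
     (\<exists>x1 \<in> extreme_points K. \<forall>\<omega> \<in> space M. x 1 \<omega> = x1) \<and>
     (\<forall>t \<ge> 1.
        (\<forall>i < m t. g t i \<in> borel_measurable M) \<and>
        v t \<in> borel_measurable M \<and>
        fresh_batch M Q m x g v t \<and>
        (\<forall>\<omega> \<in> space M.
           is_arg_min
             (\<lambda>u. u \<bullet> batch_mean m g t \<omega> + \<beta> * \<eta> t / 2 * (norm (x t \<omega> - u))\<^sup>2)
             (\<lambda>u. u \<in> extreme_points K) (v t \<omega>) \<and>
           x (t + 1) \<omega> = (1 - \<eta> t) *\<^sub>R x t \<omega> + \<eta> t *\<^sub>R v t \<omega>))"

end

theory Submission
  imports Defs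
begin

text \<open>
  Comparing the oracle's choice with the extreme points whose convex hull contains a minimizer \<open>y\<close>
  replaces the usual \<open>(diameter K)\<^sup>2\<close> in the Frank-Wolfe recursion by
  \<open>(norm (x t - y))\<^sup>2 + (diameter S)\<^sup>2\<close>. Quadratic growth bounds the first summand by a multiple of
  the current gap, for which the recursion with \<open>(diameter K)\<^sup>2\<close> already gives the rate \<open>1 / t\<close>;
  inserting this yields the improved rate. The averaged gradients enter through
  their variance, at most \<open>G\<^sup>2 / m t\<close> because distinct samples are conditionally uncorrelated.

  Induction starts at \<open>t = 2\<close>, and this start is the delicate point: the gap of \<open>x 1\<close> is not
  controlled by \<open>\<beta> * (diameter K)\<^sup>2\<close>. Two estimates of the gap of \<open>x 2\<close> are available. The smoothness
  bound \<open>\<beta> * (diameter K)\<^sup>2 / 2\<close> suffices if \<open>\<alpha> / \<beta>\<close> is at most about 9; otherwise one combines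
  quadratic growth at \<open>x 2\<close> with a bound on its gap linear in its distance to the minimizers.
\<close>

section \<open>Smooth convex functions on a convex set\<close>

lemma GDERIV_unique:
  assumes "GDERIV f x :> D" "GDERIV f x :> D'"
  shows "D = D'"
proof -
  have "(\<lambda>h. h \<bullet> D) = (\<lambda>h. h \<bullet> D')"
    using assms unfolding gderiv_def by (rule has_derivative_unique)
  then have "h \<bullet> (D - D') = 0" for h
    by (metis inner_diff_right right_minus_eq)
  from this[of "D - D'"] show ?thesis by simp
qed

text \<open>The derivative is linear, so the vector of its values on the orthonormal basis
  represents it; by uniqueness the definite description in \<open>gradient\<close> denotes this
  vector.\<close>

lemma GDERIV_gradient:
  fixes f :: "'a::euclidean_space \<Rightarrow> real"
  assumes "f differentiable (at x)"
  shows "GDERIV f x :> gradient f x"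
proof -
  obtain F where F: "(f has_derivative F) (at x)"
    using assms unfolding differentiable_def by blast
  then interpret F: linear F by (rule has_derivative_linear)
  have "F = (\<lambda>h. h \<bullet> (\<Sum>b\<in>Basis. F b *\<^sub>R b))"
  proof
    fix h
    have "F h = F (\<Sum>b\<in>Basis. (h \<bullet> b) *\<^sub>R b)" by (simp add: euclidean_representation)
    also have "\<dots> = (\<Sum>b\<in>Basis. (h \<bullet> b) * F b)" by (simp add: F.sum F.scale)
    finally show "F h = h \<bullet> (\<Sum>b\<in>Basis. F b *\<^sub>R b)"
      by (simp add: inner_sum_right mult.commute)
  qed
  with F have D: "GDERIV f x :> (\<Sum>b\<in>Basis. F b *\<^sub>R b)" by (simp add: gderiv_def)
  then have "gradient f x = (\<Sum>b\<in>Basis. F b *\<^sub>R b)"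
    unfolding gradient_def by (rule the_equality) (rule GDERIV_unique[OF _ D])
  with D show ?thesis by simp
qed

lemma has_real_derivative_along_line:
  fixes f :: "'a::euclidean_space \<Rightarrow> real"
  assumes "f differentiable (at (x + s *\<^sub>R u))"
  shows "((\<lambda>s. f (x + s *\<^sub>R u)) has_real_derivative (gradient f (x + s *\<^sub>R u) \<bullet> u)) (at s)"
proof -
  have "((\<lambda>s. x + s *\<^sub>R u) has_derivative (\<lambda>h. h *\<^sub>R u)) (at s)"
    by (auto intro!: derivative_eq_intros)
  moreover have "(f has_derivative (\<lambda>h. h \<bullet> gradient f (x + s *\<^sub>R u))) (at (x + s *\<^sub>R u))"
    using GDERIV_gradient[OF assms] by (simp add: gderiv_def)
  ultimately have "((\<lambda>s. f (x + s *\<^sub>R u)) has_derivative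
      (\<lambda>h. (h *\<^sub>R u) \<bullet> gradient f (x + s *\<^sub>R u))) (at s)"
    by (rule has_derivative_compose)
  then show ?thesis
    unfolding has_field_derivative_def 
    by (simp add: inner_commute mult_commute_abs)
qed

lemma smooth_over_differentiable:
  assumes "smooth_over \<beta> f K" "x \<in> K"
  shows "f differentiable (at x)"
  using assms unfolding smooth_over_def differentiable_on_def
  by (meson at_within_open subsetD differentiable_on_def differentiable_on_eq_differentiable_at)

lemma smooth_over_continuous_on: "smooth_over \<beta> f K \<Longrightarrow> continuous_on K f"
  by (meson continuous_at_imp_continuous_on differentiable_imp_continuous_within
      smooth_over_differentiable)

lemma smooth_over_lipschitz:
  assumes "smooth_over \<beta> f K" "x \<in> K" "y \<in> K"
  shows "norm (gradient f x - gradient f y) \<le> \<beta> * norm (x - y)"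
  using assms unfolding smooth_over_def by blast

lemma smooth_over_continuous_on_gradient:
  assumes "smooth_over \<beta> f K" "\<beta> \<ge> 0"
  shows "continuous_on K (gradient f)"
proof -
  have "\<beta>-lipschitz_on K (gradient f)"
    by (rule lipschitz_onI) (use assms in \<open>auto simp: dist_norm smooth_over_lipschitz\<close>)
  then show ?thesis by (rule lipschitz_on_continuous_on)
qed

lemma in_segment_convex:
  assumes "convex K" "x \<in> K" "y \<in> K" "0 \<le> s" "s \<le> 1"
  shows "x + s *\<^sub>R (y - x) \<in> K"
  using convexD[OF assms(1-3), of "1 - s" s] assms(4,5) by (simp add: algebra_simps)

text \<open>The function \<open>?\<psi>\<close> is \<open>f\<close> along the segment minus the rise
  of its chord, so convexity keeps it below its value at 0. A violated tangent inequality would give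
  it a positive slope there.\<close>

lemma convex_above_tangent:
  fixes f :: "'a::euclidean_space \<Rightarrow> real"
  assumes "convex_on K f" "f differentiable (at x)" "x \<in> K" "y \<in> K"
  shows "f x + gradient f x \<bullet> (y - x) \<le> f y"
proof (rule ccontr)
  assume neg: "\<not> ?thesis"
  let ?\<psi> = "\<lambda>s. f (x + s *\<^sub>R (y - x)) - s * (f y - f x)"
  have "((\<lambda>s. f (x + s *\<^sub>R (y - x))) has_real_derivative (gradient f x \<bullet> (y - x))) (at 0)"
    using has_real_derivative_along_line[of f x 0 "y - x"] assms(2) by simp
  then have "(?\<psi> has_real_derivative (gradient f x \<bullet> (y - x) - (f y - f x))) (at 0)"
    by (auto intro!: derivative_eq_intros)
  from DERIV_pos_inc_right[OF this] neg obtain d where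
    d: "d > 0" "\<And>h. 0 < h \<Longrightarrow> h < d \<Longrightarrow> ?\<psi> 0 < ?\<psi> (0 + h)" by auto
  define s where "s = min (d / 2) 1"
  have s: "0 < s" "s < d" "s \<le> 1" using d(1) by (auto simp: s_def)
  have "f (x + s *\<^sub>R (y - x)) \<le> (1 - s) * f x + s * f y"
    using convex_onD[OF assms(1), of s x y] assms s by (simp add: algebra_simps)
  with d(2)[OF s(1,2)] show False by (simp add: algebra_simps)
qed

text \<open>Subtracting the linear and quadratic terms of the claimed bound from \<open>f\<close>
  along the segment leaves a function with nonpositive derivative, by Cauchy-Schwarz and the
  Lipschitz gradient. Comparing its values at 0 and 1 avoids integrating the gradient.\<close>

lemma smooth_over_descent:
  fixes f :: "'a::euclidean_space \<Rightarrow> real"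
  assumes "smooth_over \<beta> f K" "convex K" "x \<in> K" "y \<in> K"
  shows "f y \<le> f x + gradient f x \<bullet> (y - x) + \<beta> / 2 * (norm (y - x))\<^sup>2"
proof -
  let ?u = "y - x"
  let ?\<psi> = "\<lambda>s. f (x + s *\<^sub>R ?u) - s * (gradient f x \<bullet> ?u) - s\<^sup>2 * (\<beta> / 2 * (norm ?u)\<^sup>2)"
  have "?\<psi> 1 \<le> ?\<psi> 0"
  proof (rule DERIV_nonpos_imp_nonincreasing[of 0 1 ?\<psi>])
    fix s :: real assume s: "0 \<le> s" "s \<le> 1"
    let ?w = "x + s *\<^sub>R ?u"
    have w: "?w \<in> K" using in_segment_convex assms(2-4) s by blast
    have "((\<lambda>s. f (x + s *\<^sub>R ?u)) has_real_derivative (gradient f ?w \<bullet> ?u)) (at s)"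
      by (rule has_real_derivative_along_line) (rule smooth_over_differentiable[OF assms(1) w])
    then have "(?\<psi> has_real_derivative
        (gradient f ?w \<bullet> ?u - gradient f x \<bullet> ?u - 2 * s * (\<beta> / 2 * (norm ?u)\<^sup>2))) (at s)"
      by (auto intro!: derivative_eq_intros)
    moreover have "gradient f ?w \<bullet> ?u - gradient f x \<bullet> ?u \<le> 2 * s * (\<beta> / 2 * (norm ?u)\<^sup>2)"
    proof -
      have "(gradient f ?w - gradient f x) \<bullet> ?u \<le> norm (gradient f ?w - gradient f x) * norm ?u"
        by (rule norm_cauchy_schwarz)
      also have "\<dots> \<le> (\<beta> * norm (?w - x)) * norm ?u"
        by (intro mult_right_mono smooth_over_lipschitz[OF assms(1) w assms(3)]) auto
      also have "norm (?w - x) = s * norm ?u" using s by simp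
      finally show ?thesis by (simp add: inner_diff_left power2_eq_square mult_ac)
    qed
    ultimately show "\<exists>z. (?\<psi> has_real_derivative z) (at s) \<and> z \<le> 0" by auto
  qed simp
  then show ?thesis by simp
qed

section \<open>Minimizers\<close>

lemma minimizers_iff: "y \<in> minimizers f K \<longleftrightarrow> y \<in> K \<and> (\<forall>x\<in>K. f y \<le> (f x :: real))"
  unfolding minimizers_def is_arg_min_def by (auto simp: not_less)

lemma minimizers_min_value: "y \<in> minimizers f K \<Longrightarrow> f y = min_value f K"
  unfolding min_value_def minimizers_iff
  by (intro antisym cINF_greatest cINF_lower bdd_belowI2[where m = "f y"]) auto

lemma minimizers_nonempty:
  fixes f :: "'a::topological_space \<Rightarrow> real"
  assumes "compact K" "K \<noteq> {}" "continuous_on K f"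
  shows "minimizers f K \<noteq> {}"
proof -
  obtain y where "y \<in> K" "\<forall>x\<in>K. f y \<le> f x" using continuous_attains_inf[OF assms] by blast
  then have "y \<in> minimizers f K" by (simp add: minimizers_iff)
  then show ?thesis by blast
qed

lemma minimizers_closed:
  fixes f :: "'a::t2_space \<Rightarrow> real"
  assumes "compact K" "continuous_on K f"
  shows "closed (minimizers f K)"
proof -
  have "minimizers f K = K \<inter> f -` {min_value f K}" if ne: "minimizers f K \<noteq> {}"
  proof -
    obtain y where "y \<in> minimizers f K" using ne by auto
    then show ?thesis using minimizers_min_value[of y f K] by (fastforce simp: minimizers_iff)
  qed
  moreover have "closed (K \<inter> f -` {min_value f K})"
    using assms by (intro continuous_closed_preimage compact_imp_closed) auto
  ultimately show ?thesis by (cases "minimizers f K = {}") auto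
qed

section \<open>One step with a nearest extreme point oracle\<close>

text \<open>
  The penalty bound is stated for points in a convex hull although only the points spanning it
  compete in the oracle: after subtracting \<open>c / 2 * (norm (u - y))\<^sup>2\<close> the objective is affine
  in \<open>u\<close>, hence a lower bound on \<open>S\<close> carries over to the hull.
\<close>

lemma nearest_extreme_point_hull:
  fixes x y z h :: "'a::euclidean_space"
  assumes min: "\<And>s. s \<in> S \<Longrightarrow>
      z \<bullet> h + c / 2 * (norm (x - z))\<^sup>2 \<le> s \<bullet> h + c / 2 * (norm (x - s))\<^sup>2"
    and y: "y \<in> convex hull S" and c: "c \<ge> 0"
    and r: "\<And>s. s \<in> S \<Longrightarrow> norm (s - y) \<le> r"
  shows "z \<bullet> h + c / 2 * (norm (x - z))\<^sup>2 \<le> y \<bullet> h + c / 2 * ((norm (x - y))\<^sup>2 + r\<^sup>2)"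
proof -
  let ?o = "z \<bullet> h + c / 2 * (norm (x - z))\<^sup>2"
  let ?a = "- h + c *\<^sub>R (x - y)"
  let ?b = "c / 2 * ((norm x)\<^sup>2 - (norm y)\<^sup>2) - (?o - c / 2 * r\<^sup>2)"
  have affine: "u \<bullet> h + c / 2 * (norm (x - u))\<^sup>2 - c / 2 * (norm (u - y))\<^sup>2
      = c / 2 * ((norm x)\<^sup>2 - (norm y)\<^sup>2) - ?a \<bullet> u" for u
    unfolding power2_norm_eq_inner
    by (simp add: inner_diff_left inner_diff_right inner_add_left inner_commute algebra_simps
        field_simps)
  have "S \<subseteq> {u. ?a \<bullet> u \<le> ?b}"
  proof
    fix s assume s: "s \<in> S"
    have "(norm (s - y))\<^sup>2 \<le> r\<^sup>2" using r[OF s] by (intro power_mono) auto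
    then have "c / 2 * (norm (s - y))\<^sup>2 \<le> c / 2 * r\<^sup>2" using c by (intro mult_left_mono) auto
    with min[OF s] affine[of s] show "s \<in> {u. ?a \<bullet> u \<le> ?b}" by simp
  qed
  then have "convex hull S \<subseteq> {u. ?a \<bullet> u \<le> ?b}"
    by (intro hull_minimal convex_halfspace_le)
  \<comment> \<open>At \<open>u = y\<close> the subtracted square vanishes, leaving the objective
    itself at \<open>y\<close>.\<close>
  with y have "?a \<bullet> y \<le> ?b" by blast
  with affine[of y] show ?thesis by (simp add: algebra_simps)
qed

text \<open>Here the penalty of every competitor is bounded by a constant, so only the linear term
  has to be carried from \<open>S\<close> to its hull, by a half-space. This supplies the cruder
  recursion with the squared diameter of \<open>K\<close>.\<close>

lemma nearest_extreme_point_hull_diameter: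
  fixes x y z h :: "'a::euclidean_space"
  assumes min: "\<And>s. s \<in> S \<Longrightarrow>
      z \<bullet> h + c / 2 * (norm (x - z))\<^sup>2 \<le> s \<bullet> h + c / 2 * (norm (x - s))\<^sup>2"
    and y: "y \<in> convex hull S" and c: "c \<ge> 0"
    and r: "\<And>s. s \<in> S \<Longrightarrow> norm (x - s) \<le> r"
  shows "z \<bullet> h + c / 2 * (norm (x - z))\<^sup>2 \<le> y \<bullet> h + c / 2 * r\<^sup>2"
proof -
  let ?o = "z \<bullet> h + c / 2 * (norm (x - z))\<^sup>2"
  have "S \<subseteq> {u. (- h) \<bullet> u \<le> c / 2 * r\<^sup>2 - ?o}"
  proof
    fix s assume s: "s \<in> S"
    have "(norm (x - s))\<^sup>2 \<le> r\<^sup>2" using r[OF s] by (intro power_mono) auto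
    then have "c / 2 * (norm (x - s))\<^sup>2 \<le> c / 2 * r\<^sup>2" using c by (intro mult_left_mono) auto
    with min[OF s] show "s \<in> {u. (- h) \<bullet> u \<le> c / 2 * r\<^sup>2 - ?o}" by (simp add: inner_commute)
  qed
  then have "convex hull S \<subseteq> {u. (- h) \<bullet> u \<le> c / 2 * r\<^sup>2 - ?o}"
    by (intro hull_minimal convex_halfspace_le)
  with y show ?thesis by (auto simp: inner_commute)
qed

text \<open>The closed ball of radius \<open>diameter S\<close> around \<open>s\<close> is convex
  and contains \<open>S\<close>, hence also its hull.\<close>

lemma hull_dist_le_diameter:
  fixes S :: "'a::real_normed_vector set"
  assumes "bounded S" "y \<in> convex hull S" "s \<in> S"
  shows "norm (s - y) \<le> diameter S"
proof -
  have "S \<subseteq> cball s (diameter S)"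
    using diameter_bounded_bound[OF assms(1,3)] by auto
  then have "convex hull S \<subseteq> cball s (diameter S)" by (intro hull_minimal convex_cball)
  with assms(2) show ?thesis by (auto simp: dist_norm)
qed

text \<open>\<open>h\<close> stands for the estimated gradient; replacing it by the true one in the
  oracle inequality costs an inner product with \<open>y - z\<close>, bounded by Cauchy-Schwarz.
  \<open>W\<close> stays abstract so that either penalty bound can be inserted.\<close>

lemma frank_wolfe_step:
  fixes f :: "'a::euclidean_space \<Rightarrow> real"
  assumes "smooth_over \<beta> f K" "convex K" "convex_on K f"
    and "x \<in> K" "z \<in> K" "y \<in> K" and \<eta>: "0 \<le> \<eta>" "\<eta> \<le> 1"
    and opt: "z \<bullet> h + \<beta> * \<eta> / 2 * (norm (x - z))\<^sup>2 \<le> y \<bullet> h + \<beta> * \<eta> / 2 * W"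
  shows "f ((1 - \<eta>) *\<^sub>R x + \<eta> *\<^sub>R z) - f y
    \<le> (1 - \<eta>) * (f x - f y) + \<beta> * \<eta>\<^sup>2 / 2 * W + \<eta> * (norm (z - y) * norm (h - gradient f x))"
proof -
  let ?g = "gradient f x"
  have eq: "(1 - \<eta>) *\<^sub>R x + \<eta> *\<^sub>R z = x + \<eta> *\<^sub>R (z - x)" by (simp add: algebra_simps)
  have "x + \<eta> *\<^sub>R (z - x) \<in> K" using in_segment_convex assms(2,4,5) \<eta> by blast
  from smooth_over_descent[OF assms(1,2,4) this]
  have 1: "f (x + \<eta> *\<^sub>R (z - x)) \<le> f x + \<eta> * (?g \<bullet> (z - x)) + \<beta> / 2 * (\<eta> * norm (z - x))\<^sup>2"
    using \<eta> by simp
  have 2: "f x + ?g \<bullet> (y - x) \<le> f y"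
    using convex_above_tangent smooth_over_differentiable assms by blast
  have 3: "(y - z) \<bullet> (h - ?g) \<le> norm (z - y) * norm (h - ?g)"
    by (metis norm_cauchy_schwarz norm_minus_commute)
  have "?g \<bullet> (z - x) + \<beta> * \<eta> / 2 * (norm (z - x))\<^sup>2
      \<le> f y - f x + \<beta> * \<eta> / 2 * W + norm (z - y) * norm (h - ?g)"
    using opt 2 3 by (simp add: inner_diff_left inner_diff_right inner_commute norm_minus_commute)
  then have "\<eta> * (?g \<bullet> (z - x) + \<beta> * \<eta> / 2 * (norm (z - x))\<^sup>2)
      \<le> \<eta> * (f y - f x + \<beta> * \<eta> / 2 * W + norm (z - y) * norm (h - ?g))"
    using \<eta> by (intro mult_left_mono)
  with 1 show ?thesis unfolding eq by (simp add: algebra_simps power2_eq_square)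
qed

text \<open>
  For a full step the excess of the new point over \<open>y\<close> is at most linear in its distance to
  \<open>y\<close>. The gradient at \<open>z\<close> is only used on the way from \<open>z\<close> to the segment between \<open>x\<close> and
  \<open>y\<close>; along that segment convexity alone suffices. This saves the factor \<open>sqrt 2\<close> over the
  immediate bound, without which the constant of the theorem would not be reached at \<open>t = 2\<close>.
\<close>

lemma full_step_linear_bound:
  fixes f :: "'a::euclidean_space \<Rightarrow> real"
  assumes sm: "smooth_over \<beta> f K" and cv: "convex K" "convex_on K f" and \<beta>: "\<beta> \<ge> 0"
    and K: "x \<in> K" "z \<in> K" "y \<in> K"
    and D: "norm (x - y) \<le> D" "norm (x - z) \<le> D"
    and opt: "z \<bullet> h + \<beta> / 2 * (norm (x - z))\<^sup>2 \<le> y \<bullet> h + \<beta> / 2 * ((norm (x - y))\<^sup>2 + r)"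
  shows "f z - f y \<le> sqrt 2 * \<beta> * D * norm (z - y) + \<beta> / 2 * r
    + norm (z - y) * norm (h - gradient f x)"
proof -
  let ?g = "gradient f x"
  let ?I = "closed_segment x y"
  \<comment> \<open>The way from \<open>z\<close> to \<open>y\<close> is split at the point of the
    segment nearest to \<open>z\<close>; \<open>d\<close> and \<open>b\<close> are the lengths of
    the two legs.\<close>
  define w where "w = closest_point ?I z"
  have wI: "w \<in> ?I" unfolding w_def by (intro closest_point_in_set) auto
  then have wK: "w \<in> K" using closed_segment_subset K cv(1) by blast
  obtain s where s: "0 \<le> s" "s \<le> 1" "w = (1 - s) *\<^sub>R x + s *\<^sub>R y"
    using wI unfolding in_segment by auto
  define b d where "b = norm (y - w)" and "d = norm (z - w)"
  \<comment> \<open>Projection onto a convex set: the angle at \<open>w\<close> between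
    \<open>z\<close> and any point of the segment is not acute.\<close>
  have dot: "(z - w) \<bullet> (u - w) \<le> 0" if "u \<in> ?I" for u
    unfolding w_def by (rule closest_point_dot) (use that in auto)
  have diff: "f differentiable at u" if "u \<in> K" for u
    using that smooth_over_differentiable sm by blast
  have "f z - f w \<le> gradient f z \<bullet> (z - w)"
    using convex_above_tangent[OF cv(2) diff[OF K(2)] K(2) wK] by (simp add: inner_diff_right)
  also have "\<dots> = ?g \<bullet> (z - w) + (gradient f z - ?g) \<bullet> (z - w)" by (simp add: inner_diff_left)
  also have "(gradient f z - ?g) \<bullet> (z - w) \<le> norm (gradient f z - ?g) * d"
    unfolding d_def by (rule norm_cauchy_schwarz)
  also have "\<dots> \<le> (\<beta> * norm (z - x)) * d"
    unfolding d_def by (intro mult_right_mono smooth_over_lipschitz[OF sm]) (use K in auto)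
  also have "\<dots> \<le> (\<beta> * D) * d"
    using D \<beta> by (intro mult_right_mono mult_left_mono) (auto simp: norm_minus_commute d_def)
  finally have 1: "f z - f w \<le> ?g \<bullet> (z - w) + \<beta> * D * d" by simp
  \<comment> \<open>The chord bounds \<open>f\<close> at \<open>w\<close>, and the tangent at
    \<open>x\<close> bounds the slope of the chord.\<close>
  have "f w \<le> (1 - s) * f x + s * f y"
    unfolding s(3) using convex_onD[OF cv(2), of s x y] s K by simp
  moreover have "(1 - s) * (f x - f y) \<le> (1 - s) * (?g \<bullet> (x - y))"
    using convex_above_tangent[OF cv(2) diff[OF K(1)] K(1,3)] s(2)
    by (intro mult_left_mono) (auto simp: inner_diff_right)
  moreover have "(1 - s) * (?g \<bullet> (x - y)) = ?g \<bullet> (w - y)"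
    unfolding s(3) by (simp add: inner_diff_right inner_add_right algebra_simps)
  ultimately have 2: "f w - f y \<le> ?g \<bullet> (w - y)" by (simp add: algebra_simps)
  have 3: "(y - z) \<bullet> (h - ?g) \<le> norm (z - y) * norm (h - ?g)"
    by (metis norm_cauchy_schwarz norm_minus_commute)
  have n1: "(norm (z - y))\<^sup>2 = d\<^sup>2 + b\<^sup>2 - 2 * ((z - w) \<bullet> (y - w))"
    unfolding d_def b_def power2_norm_eq_inner
    by (simp add: inner_diff_left inner_diff_right inner_commute algebra_simps)
  have n2: "(norm (x - z))\<^sup>2 = d\<^sup>2 + (norm (x - w))\<^sup>2 - 2 * ((z - w) \<bullet> (x - w))"
    unfolding d_def power2_norm_eq_inner
    by (simp add: inner_diff_left inner_diff_right inner_commute algebra_simps)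
  have xw: "norm (x - y) = norm (x - w) + b"
  proof -
    have "x - w = s *\<^sub>R (x - y)" "y - w = (1 - s) *\<^sub>R (y - x)"
      unfolding s(3) by (simp_all add: algebra_simps)
    then have "norm (x - w) = s * norm (x - y)" "b = (1 - s) * norm (x - y)"
      unfolding b_def using s by (simp_all add: norm_minus_commute)
    then show ?thesis by (simp add: algebra_simps)
  qed
  \<comment> \<open>By the angle at \<open>w\<close>, the point \<open>z\<close> is at least as far
    from \<open>x\<close> as \<open>w\<close> is, so the two penalties differ by an amount at most
    linear in \<open>b\<close>.\<close>
  have "norm (x - y) - b = norm (x - w)" using xw by simp
  then have "(norm (x - y))\<^sup>2 - (norm (x - z))\<^sup>2 \<le> (norm (x - y))\<^sup>2 - (norm (x - y) - b)\<^sup>2"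
    using n2 dot[OF ends_in_segment(1)] zero_le_power2[of d] by (simp only:)
  also have "\<dots> \<le> 2 * norm (x - y) * b" by (simp add: power2_eq_square algebra_simps)
  also have "\<dots> \<le> 2 * D * b" using D by (intro mult_right_mono) (auto simp: b_def)
  finally have "\<beta> / 2 * ((norm (x - y))\<^sup>2 - (norm (x - z))\<^sup>2) \<le> \<beta> / 2 * (2 * D * b)"
    using \<beta> by (intro mult_left_mono) auto
  then have "f z - f y \<le> \<beta> * D * (b + d) + \<beta> / 2 * r + norm (z - y) * norm (h - ?g)"
    using 1 2 3 opt
    by (simp add: inner_diff_left inner_diff_right inner_commute algebra_simps)
  \<comment> \<open>The angle at \<open>w\<close> makes the squares of the two legs sum to at most
    that of \<open>norm (z - y)\<close>; the factor \<open>sqrt 2\<close> is the cost of passing to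
    the sum of the legs.\<close>
  also have "b + d \<le> sqrt 2 * norm (z - y)"
  proof (rule power2_le_imp_le)
    have "(b + d)\<^sup>2 \<le> 2 * (d\<^sup>2 + b\<^sup>2)"
      using sum_squares_ge_zero[of "b - d" 0] by (simp add: power2_eq_square algebra_simps)
    also have "\<dots> \<le> 2 * (norm (z - y))\<^sup>2" using n1 dot[of y] by simp
    finally show "(b + d)\<^sup>2 \<le> (sqrt 2 * norm (z - y))\<^sup>2" by (simp add: power_mult_distrib)
  qed simp
  then have "\<beta> * D * (b + d) \<le> \<beta> * D * (sqrt 2 * norm (z - y))"
    using \<beta> D(1) norm_ge_zero[of "x - y"] by (intro mult_left_mono mult_nonneg_nonneg) linarith+
  finally show ?thesis by (simp add: mult_ac)
qed

section \<open>Samples drawn from a kernel\<close>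

text \<open>The joint law of \<open>X\<close> and \<open>Y\<close> and the law obtained by drawing
  from \<open>\<kappa>\<close> given \<open>X\<close> agree on an intersection-stable family of
  rectangles, hence everywhere. The generator \<open>E\<close> is kept general because
  \<open>T\<close> may itself be a product on which \<open>law\<close> is known for rectangles
  only.\<close>

lemma (in prob_space) integral_kernel:
  fixes F :: "'b \<times> 'c \<Rightarrow> real"
  assumes \<kappa>[measurable]: "\<kappa> \<in> S \<rightarrow>\<^sub>M prob_algebra T"
    and X[measurable]: "X \<in> M \<rightarrow>\<^sub>M S" and Y[measurable]: "Y \<in> M \<rightarrow>\<^sub>M T"
    and E: "Int_stable E" "E \<subseteq> Pow (space T)" "sets T = sigma_sets (space T) E" "space T \<in> E"
    and law: "\<And>A B. A \<in> sets S \<Longrightarrow> B \<in> E \<Longrightarrow>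
      prob {\<omega> \<in> space M. X \<omega> \<in> A \<and> Y \<omega> \<in> B} = (\<integral>\<omega>. indicator A (X \<omega>) * measure (\<kappa> (X \<omega>)) B \<partial>M)"
    and F[measurable]: "F \<in> borel_measurable (S \<Otimes>\<^sub>M T)"
    and bound: "\<And>p. p \<in> space (S \<Otimes>\<^sub>M T) \<Longrightarrow> \<bar>F p\<bar> \<le> c"
  shows "(\<integral>\<omega>. F (X \<omega>, Y \<omega>) \<partial>M) = (\<integral>\<omega>. (\<integral>y. F (X \<omega>, y) \<partial>\<kappa> (X \<omega>)) \<partial>M)"
proof -
  let ?N = "S \<Otimes>\<^sub>M T"
  let ?L = "\<lambda>\<omega>. distr (\<kappa> (X \<omega>)) ?N (Pair (X \<omega>))"
  have L[measurable]: "?L \<in> M \<rightarrow>\<^sub>M prob_algebra ?N"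
    by (rule measurable_distr_prob_space2[where M=T, OF measurable_compose[OF X \<kappa>]]) measurable
  have Ls: "?L \<in> M \<rightarrow>\<^sub>M subprob_algebra ?N" by (rule measurable_prob_algebraD[OF L])
  have ps: "prob_space (\<kappa> (X \<omega>))" and sets\<kappa>: "sets (\<kappa> (X \<omega>)) = sets T"
    and X_S: "X \<omega> \<in> space S" if "\<omega> \<in> space M" for \<omega>
    using measurable_space[OF \<kappa> measurable_space[OF X that]] measurable_space[OF X that]
    by (auto simp: space_prob_algebra)
  have PairX: "Pair (X \<omega>) \<in> \<kappa> (X \<omega>) \<rightarrow>\<^sub>M ?N" if "\<omega> \<in> space M" for \<omega>
    using measurable_Pair1'[OF X_S[OF that], of T] measurable_cong_sets[OF sets\<kappa>[OF that] refl, of ?N]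
    by simp
  have "distr M ?N (\<lambda>\<omega>. (X \<omega>, Y \<omega>)) = M \<bind> ?L"
  proof (rule measure_eqI_generator_eq)
    let ?G = "{a \<times> b |a b. a \<in> sets S \<and> b \<in> E}"
    show "Int_stable ?G"
    proof (rule Int_stableI)
      fix u w assume "u \<in> ?G" "w \<in> ?G"
      then obtain a b a' b' where "u = a \<times> b" "w = a' \<times> b'"
        "a \<in> sets S" "a' \<in> sets S" "b \<in> E" "b' \<in> E" by blast
      moreover from this E(1) have "b \<inter> b' \<in> E" by (auto simp: Int_stable_def)
      ultimately show "u \<inter> w \<in> ?G" by (auto simp: Times_Int_Times)
    qed
    show "?G \<subseteq> Pow (space S \<times> space T)" using E(2) by (auto dest: sets.sets_into_space)
    have gen: "sets ?N = sigma_sets (space S \<times> space T) ?G"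
    proof -
      have "sets ?N = sets (sigma (space S \<times> space T) ?G)"
        by (rule sets_pair_eq[where Ca="{space S}" and Cb="{space T}"])
          (use E in \<open>auto simp: sets.space_closed sets.sigma_sets_eq\<close>)
      then show ?thesis using \<open>?G \<subseteq> Pow _\<close> by simp
    qed
    then show "sets (distr M ?N (\<lambda>\<omega>. (X \<omega>, Y \<omega>))) = sigma_sets (space S \<times> space T) ?G" by simp
    show "sets (M \<bind> ?L) = sigma_sets (space S \<times> space T) ?G"
      using gen sets_bind_measurable[OF Ls not_empty] by simp
    show "range (\<lambda>i::nat. space S \<times> space T) \<subseteq> ?G" using E(4) by auto
    show "(\<Union>i::nat. space S \<times> space T) = space S \<times> space T" by simp
    show "emeasure (distr M ?N (\<lambda>\<omega>. (X \<omega>, Y \<omega>))) (space S \<times> space T) \<noteq> \<infinity>" for i :: nat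
      by (subst emeasure_distr) (auto simp: space_pair_measure[symmetric])
    fix Z assume "Z \<in> ?G"
    then obtain A B where Z: "Z = A \<times> B" and A[measurable]: "A \<in> sets S" and BE: "B \<in> E"
      by blast
    have B[measurable]: "B \<in> sets T" using BE E(3) by auto
    have "emeasure (distr M ?N (\<lambda>\<omega>. (X \<omega>, Y \<omega>))) Z = emeasure M {\<omega> \<in> space M. X \<omega> \<in> A \<and> Y \<omega> \<in> B}"
      unfolding Z by (subst emeasure_distr) (auto intro!: arg_cong[where f="emeasure M"])
    also have "\<dots> = ennreal (\<integral>\<omega>. indicator A (X \<omega>) * measure (\<kappa> (X \<omega>)) B \<partial>M)"
      using law[OF A BE] by (simp add: emeasure_eq_measure)
    also have "\<dots> = (\<integral>\<^sup>+\<omega>. ennreal (indicator A (X \<omega>) * measure (\<kappa> (X \<omega>)) B) \<partial>M)"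
    proof (rule nn_integral_eq_integral[symmetric])
      show "integrable M (\<lambda>\<omega>. indicator A (X \<omega>) * measure (\<kappa> (X \<omega>)) B)"
      proof (rule integrable_const_bound[where B=1])
        show "AE \<omega> in M. norm (indicator A (X \<omega>) * measure (\<kappa> (X \<omega>)) B) \<le> 1"
          using prob_space.prob_le_1[OF ps] by (intro AE_I2) (auto simp: indicator_def)
      qed measurable
    qed auto
    also have "\<dots> = (\<integral>\<^sup>+\<omega>. emeasure (?L \<omega>) Z \<partial>M)"
    proof (rule nn_integral_cong)
      fix \<omega> assume \<omega>: "\<omega> \<in> space M"
      interpret \<kappa>: prob_space "\<kappa> (X \<omega>)" by (rule ps[OF \<omega>])
      have "emeasure (?L \<omega>) Z = emeasure (\<kappa> (X \<omega>)) (Pair (X \<omega>) -` Z \<inter> space (\<kappa> (X \<omega>)))"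
        unfolding Z by (rule emeasure_distr[OF PairX[OF \<omega>]]) simp
      \<comment> \<open>The section of the rectangle at \<open>X \<omega>\<close> is
        \<open>B\<close> or empty, matching the indicator.\<close>
      also have "Pair (X \<omega>) -` Z \<inter> space (\<kappa> (X \<omega>)) = (if X \<omega> \<in> A then B else {})"
        using sets_eq_imp_space_eq[OF sets\<kappa>[OF \<omega>]] sets.sets_into_space[OF B] by (auto simp: Z)
      finally show "ennreal (indicator A (X \<omega>) * measure (\<kappa> (X \<omega>)) B) = emeasure (?L \<omega>) Z"
        by (auto simp: \<kappa>.emeasure_eq_measure)
    qed
    also have "\<dots> = emeasure (M \<bind> ?L) Z"
      by (subst emeasure_bind[OF not_empty Ls]) (auto simp: Z)
    finally show "emeasure (distr M ?N (\<lambda>\<omega>. (X \<omega>, Y \<omega>))) Z = emeasure (M \<bind> ?L) Z" .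
  qed
  note eq = this
  have "(\<integral>\<omega>. F (X \<omega>, Y \<omega>) \<partial>M) = integral\<^sup>L (M \<bind> ?L) F"
    by (simp add: eq[symmetric] integral_distr)
  also have "\<dots> = (\<integral>\<omega>. integral\<^sup>L (?L \<omega>) F \<partial>M)"
  proof (rule integral_bind[where K="?N" and B=c and B'=1])
    have "emeasure (?L \<omega>) (space (?L \<omega>)) = 1" if "\<omega> \<in> space M" for \<omega>
      using measurable_space[OF L that]
      by (intro prob_space.emeasure_space_1) (simp add: space_prob_algebra)
    then show "AE \<omega> in M. emeasure (?L \<omega>) (space (?L \<omega>)) \<le> ennreal 1"
      by (intro AE_I2) (simp only: ennreal_1 order_refl)
  qed (use bound Ls finite_measure_axioms in auto)
  also have "\<dots> = (\<integral>\<omega>. (\<integral>y. F (X \<omega>, y) \<partial>\<kappa> (X \<omega>)) \<partial>M)"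
    by (intro Bochner_Integration.integral_cong refl integral_distr) (use PairX in auto)
  finally show ?thesis .
qed

text \<open>Of the history only the current iterate \<open>X\<close> remains. Given
  \<open>X\<close>, the samples \<open>Y i\<close> are independent with law
  \<open>Q (X \<omega>)\<close>, which \<open>law\<close> records through probabilities of
  rectangles; \<open>\<mu>\<close> becomes the gradient of \<open>f\<close>.\<close>

locale conditional_sample = prob_space M for M :: "'w measure" +
  fixes K :: "'a::euclidean_space set" and Q :: "'a \<Rightarrow> 'a measure"
    and X :: "'w \<Rightarrow> 'a" and Y :: "nat \<Rightarrow> 'w \<Rightarrow> 'a" and n :: nat and G :: real and \<mu> :: "'a \<Rightarrow> 'a"
  assumes kernel: "Q \<in> restrict_space borel K \<rightarrow>\<^sub>M prob_algebra borel"
    and X: "X \<in> M \<rightarrow>\<^sub>M restrict_space borel K"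
    and Y: "\<And>i. i < n \<Longrightarrow> Y i \<in> borel_measurable M"
    and law: "\<And>A B. A \<in> sets borel \<Longrightarrow> (\<And>i. i < n \<Longrightarrow> B i \<in> sets borel) \<Longrightarrow>
      prob {\<omega> \<in> space M. X \<omega> \<in> A \<and> (\<forall>i<n. Y i \<omega> \<in> B i)}
      = (\<integral>\<omega>. indicator A (X \<omega>) * (\<Prod>i<n. measure (Q (X \<omega>)) (B i)) \<partial>M)"
    and G: "G \<ge> 0"
    and bounded: "\<And>x. x \<in> K \<Longrightarrow> AE y in Q x. norm y \<le> G"
    and mean: "\<And>x. x \<in> K \<Longrightarrow> (\<integral>y. y \<partial>Q x) = \<mu> x"
    and \<mu>: "\<mu> \<in> borel_measurable (restrict_space borel K)"
begin

text \<open>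
  Almost surely \<open>clip\<close> changes nothing; it makes the integrands below bounded everywhere.
\<close>

definition clip :: "'a \<Rightarrow> 'a" where
  "clip y = (if norm y \<le> G then y else 0)"

lemma clip_measurable[measurable]: "clip \<in> borel_measurable borel"
  unfolding clip_def by measurable

lemma norm_clip: "norm (clip y) \<le> G"
  using G by (simp add: clip_def)

lemma X_in: "\<omega> \<in> space M \<Longrightarrow> X \<omega> \<in> K"
  using measurable_space[OF X] by (simp add: space_restrict_space)

section \<open>Moments of clipped samples under the kernel\<close>

context
  fixes x assumes x: "x \<in> K"
begin

lemma kernel_prob: "prob_space (Q x)" and sets_kernel: "sets (Q x) = sets borel"
  using measurable_space[OF kernel, of x] x by (auto simp: space_restrict_space space_prob_algebra)

lemma clip_integrable: "integrable (Q x) clip"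
proof -
  interpret Q: prob_space "Q x" by (rule kernel_prob)
  show ?thesis
    by (rule Q.integrable_const_bound[where B=G])
      (auto simp: norm_clip sets_kernel cong: measurable_cong_sets)
qed

lemma clip_mean: "(\<integral>y. clip y \<partial>Q x) = \<mu> x"
proof -
  have "(\<integral>y. clip y \<partial>Q x) = (\<integral>y. y \<partial>Q x)"
    by (rule integral_cong_AE)
      (use bounded[OF x] in \<open>auto simp: clip_def sets_kernel elim: eventually_mono
        cong: measurable_cong_sets\<close>)
  then show ?thesis using mean[OF x] by simp
qed

lemma norm_\<mu>: "norm (\<mu> x) \<le> G"
proof -
  interpret Q: prob_space "Q x" by (rule kernel_prob)
  have "norm (\<mu> x) \<le> (\<integral>y. norm (clip y) \<partial>Q x)"
    unfolding clip_mean[symmetric] by (rule integral_norm_bound)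
  also have "\<dots> \<le> (\<integral>y. G \<partial>Q x)"
    by (intro integral_mono integrable_norm clip_integrable) (auto simp: norm_clip)
  finally show ?thesis by (simp add: Q.prob_space)
qed

text \<open>The variance is the second moment minus the squared norm of the mean, so centring does
  not enlarge the bound.\<close>

lemma clip_variance: "(\<integral>y. (norm (clip y - \<mu> x))\<^sup>2 \<partial>Q x) \<le> G\<^sup>2"
proof -
  interpret Q: prob_space "Q x" by (rule kernel_prob)
  have sq: "integrable (Q x) (\<lambda>y. clip y \<bullet> clip y)"
  proof (rule Q.integrable_const_bound[where B="G\<^sup>2"])
    show "AE y in Q x. norm (clip y \<bullet> clip y) \<le> G\<^sup>2"
      using norm_clip by (intro AE_I2) (simp add: power2_norm_eq_inner[symmetric] power_mono)
  qed (simp add: sets_kernel cong: measurable_cong_sets)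
  have "(\<integral>y. (norm (clip y - \<mu> x))\<^sup>2 \<partial>Q x)
    = (\<integral>y. clip y \<bullet> clip y - 2 * (clip y \<bullet> \<mu> x) + \<mu> x \<bullet> \<mu> x \<partial>Q x)"
    unfolding power2_norm_eq_inner
    by (intro Bochner_Integration.integral_cong refl)
      (simp add: inner_diff_left inner_diff_right inner_commute)
  also have "\<dots> = (\<integral>y. clip y \<bullet> clip y \<partial>Q x) - \<mu> x \<bullet> \<mu> x"
    using sq clip_integrable by (simp add: clip_mean Q.prob_space)
  also have "\<dots> \<le> (\<integral>y. clip y \<bullet> clip y \<partial>Q x)" by simp
  also have "\<dots> \<le> (\<integral>y. G\<^sup>2 \<partial>Q x)"
    by (intro integral_mono sq) (auto simp: power2_norm_eq_inner[symmetric] norm_clip power_mono)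
  finally show ?thesis by (simp add: Q.prob_space)
qed

text \<open>By Fubini, the inner integral pairs a fixed vector with a centred one and
  vanishes.\<close>

lemma clip_covariance:
  "(\<integral>p. (clip (fst p) - \<mu> x) \<bullet> (clip (snd p) - \<mu> x) \<partial>(Q x \<Otimes>\<^sub>M Q x)) = 0"
proof -
  interpret Q: prob_space "Q x" by (rule kernel_prob)
  interpret QQ: pair_prob_space "Q x" "Q x" by unfold_locales
  let ?h = "\<lambda>p. (clip (fst p) - \<mu> x) \<bullet> (clip (snd p) - \<mu> x)"
  have [measurable]: "clip \<in> borel_measurable (Q x)"
    using clip_integrable by (rule borel_measurable_integrable)
  have b: "norm (clip y - \<mu> x) \<le> 2 * G" for y
    using norm_triangle_ineq4[of "clip y" "\<mu> x"] norm_clip[of y] norm_\<mu> by simp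
  have "integrable (Q x \<Otimes>\<^sub>M Q x) ?h"
  proof (rule QQ.P.integrable_const_bound[where B="(2 * G) * (2 * G)"])
    show "AE p in Q x \<Otimes>\<^sub>M Q x. norm (?h p) \<le> (2 * G) * (2 * G)"
      unfolding real_norm_def
      by (intro AE_I2 order_trans[OF Cauchy_Schwarz_ineq2] mult_mono b) (use G in auto)
  qed measurable
  from QQ.integral_fst'[OF this]
  have "(\<integral>p. ?h p \<partial>(Q x \<Otimes>\<^sub>M Q x))
      = (\<integral>y. (\<integral>y'. (clip y - \<mu> x) \<bullet> (clip y' - \<mu> x) \<partial>Q x) \<partial>Q x)" by simp
  also have "\<dots> = (\<integral>y. 0 \<partial>Q x)"
  proof (intro Bochner_Integration.integral_cong refl)
    fix y
    have "(\<integral>y'. (clip y - \<mu> x) \<bullet> (clip y' - \<mu> x) \<partial>Q x)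
      = (clip y - \<mu> x) \<bullet> (\<integral>y'. clip y' - \<mu> x \<partial>Q x)"
      by (intro integral_inner_right) (simp add: clip_integrable)
    also have "(\<integral>y'. clip y' - \<mu> x \<partial>Q x) = 0"
      by (simp add: clip_integrable clip_mean Q.prob_space)
    finally show "(\<integral>y'. (clip y - \<mu> x) \<bullet> (clip y' - \<mu> x) \<partial>Q x) = 0" by simp
  qed
  finally show ?thesis by simp
qed

end

section \<open>Joint law of the iterate with one or two samples\<close>

lemma law_single:
  assumes i: "i < n" and A: "A \<in> sets borel" and B: "B \<in> sets borel"
  shows "prob {\<omega> \<in> space M. X \<omega> \<in> A \<and> Y i \<omega> \<in> B}
    = (\<integral>\<omega>. indicator A (X \<omega>) * measure (Q (X \<omega>)) B \<partial>M)"
proof -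
  \<comment> \<open>The other samples are left unconstrained and contribute factors 1.\<close>
  let ?B = "\<lambda>k. if k = i then B else UNIV"
  have prod: "(\<Prod>k<n. measure (Q x) (?B k)) = measure (Q x) B" if "x \<in> K" for x
  proof -
    interpret Q: prob_space "Q x" by (rule kernel_prob[OF that])
    have "Q.prob UNIV = 1"
      using Q.prob_space sets_eq_imp_space_eq[OF sets_kernel[OF that]] by simp
    then show ?thesis using i
      by (subst prod.remove[of _ i]) (auto intro!: prod.neutral)
  qed
  have "{\<omega> \<in> space M. X \<omega> \<in> A \<and> Y i \<omega> \<in> B} = {\<omega> \<in> space M. X \<omega> \<in> A \<and> (\<forall>k<n. Y k \<omega> \<in> ?B k)}"
    using i by auto
  also have "prob \<dots> = (\<integral>\<omega>. indicator A (X \<omega>) * (\<Prod>k<n. measure (Q (X \<omega>)) (?B k)) \<partial>M)"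
    using A B by (intro law) auto
  also have "\<dots> = (\<integral>\<omega>. indicator A (X \<omega>) * measure (Q (X \<omega>)) B \<partial>M)"
    by (intro Bochner_Integration.integral_cong refl) (simp only: prod X_in)
  finally show ?thesis .
qed

text \<open>Two factors of the product over the batch survive. They are written as a product measure
  because the pair is treated below as a single draw from
  \<open>Q x \<Otimes>\<^sub>M Q x\<close>.\<close>

lemma law_pair:
  assumes ij: "i < n" "j < n" "i \<noteq> j"
    and A: "A \<in> sets borel" and B: "B \<in> sets borel" "C \<in> sets borel"
  shows "prob {\<omega> \<in> space M. X \<omega> \<in> A \<and> (Y i \<omega>, Y j \<omega>) \<in> B \<times> C}
    = (\<integral>\<omega>. indicator A (X \<omega>) * measure (Q (X \<omega>) \<Otimes>\<^sub>M Q (X \<omega>)) (B \<times> C) \<partial>M)"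
proof -
  let ?B = "\<lambda>k. if k = i then B else if k = j then C else UNIV"
  have prod: "(\<Prod>k<n. measure (Q x) (?B k)) = measure (Q x \<Otimes>\<^sub>M Q x) (B \<times> C)" if "x \<in> K" for x
  proof -
    interpret Q: prob_space "Q x" by (rule kernel_prob[OF that])
    interpret QQ: pair_prob_space "Q x" "Q x" by unfold_locales
    have "Q.prob UNIV = 1"
      using Q.prob_space sets_eq_imp_space_eq[OF sets_kernel[OF that]] by simp
    then have "(\<Prod>k<n. measure (Q x) (?B k)) = measure (Q x) B * measure (Q x) C"
      using ij
      by (subst prod.remove[of _ i], simp, simp, subst prod.remove[of _ j])
        (auto intro!: prod.neutral)
    also have "\<dots> = measure (Q x \<Otimes>\<^sub>M Q x) (B \<times> C)"
      using Q.emeasure_pair_measure_Times[of B "Q x" C] B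
      by (simp add: measure_def enn2real_mult sets_kernel[OF that])
    finally show ?thesis .
  qed
  have "{\<omega> \<in> space M. X \<omega> \<in> A \<and> (Y i \<omega>, Y j \<omega>) \<in> B \<times> C}
      = {\<omega> \<in> space M. X \<omega> \<in> A \<and> (\<forall>k<n. Y k \<omega> \<in> ?B k)}"
    using ij by auto
  also have "prob \<dots> = (\<integral>\<omega>. indicator A (X \<omega>) * (\<Prod>k<n. measure (Q (X \<omega>)) (?B k)) \<partial>M)"
    using A B by (intro law) auto
  also have "\<dots> = (\<integral>\<omega>. indicator A (X \<omega>) * measure (Q (X \<omega>) \<Otimes>\<^sub>M Q (X \<omega>)) (B \<times> C) \<partial>M)"
    by (intro Bochner_Integration.integral_cong refl) (simp only: prod X_in)
  finally show ?thesis .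
qed

lemma sample_bounded:
  assumes "i < n" shows "AE \<omega> in M. norm (Y i \<omega>) \<le> G"
proof -
  have [measurable]: "Y i \<in> borel_measurable M" by (rule Y[OF assms])
  have "prob {\<omega> \<in> space M. X \<omega> \<in> UNIV \<and> Y i \<omega> \<in> cball 0 G}
    = (\<integral>\<omega>. indicator UNIV (X \<omega>) * measure (Q (X \<omega>)) (cball 0 G) \<partial>M)"
    by (intro law_single assms) auto
  also have "\<dots> = (\<integral>\<omega>. 1 \<partial>M)"
  proof (intro Bochner_Integration.integral_cong refl)
    fix \<omega> assume "\<omega> \<in> space M"
    then have K: "X \<omega> \<in> K" by (rule X_in)
    interpret Q: prob_space "Q (X \<omega>)" by (rule kernel_prob[OF K])
    have "measure (Q (X \<omega>)) (cball 0 G) = 1"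
      using bounded[OF K] by (subst Q.prob_eq_1) (auto simp: sets_kernel[OF K])
    then show "indicator UNIV (X \<omega>) * measure (Q (X \<omega>)) (cball 0 G) = (1::real)" by simp
  qed
  finally have "prob {\<omega> \<in> space M. norm (Y i \<omega>) \<le> G} = 1" by (simp add: prob_space)
  then show ?thesis by (subst (asm) prob_eq_1) auto
qed

lemma \<mu>_X[measurable]: "(\<lambda>\<omega>. \<mu> (X \<omega>)) \<in> borel_measurable M"
  using measurable_compose[OF X \<mu>] .

lemma clip_variance_sample:
  assumes i: "i < n"
  shows "(\<integral>\<omega>. (norm (clip (Y i \<omega>) - \<mu> (X \<omega>)))\<^sup>2 \<partial>M) \<le> G\<^sup>2"
proof -
  let ?F = "\<lambda>p. (norm (clip (snd p) - \<mu> (fst p)))\<^sup>2"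
  note \<mu>[measurable]
  have "(\<integral>\<omega>. ?F (X \<omega>, Y i \<omega>) \<partial>M) = (\<integral>\<omega>. (\<integral>y. ?F (X \<omega>, y) \<partial>Q (X \<omega>)) \<partial>M)"
  proof (rule integral_kernel[OF kernel X Y[OF i], where E="sets borel" and c="(2 * G)\<^sup>2"])
    fix p :: "'a \<times> 'a" assume p: "p \<in> space (restrict_space borel K \<Otimes>\<^sub>M borel)"
    then have "norm (\<mu> (fst p)) \<le> G"
      by (intro norm_\<mu>) (auto simp: space_pair_measure space_restrict_space)
    then have "norm (clip (snd p) - \<mu> (fst p)) \<le> 2 * G"
      using norm_triangle_ineq4[of "clip (snd p)" "\<mu> (fst p)"] norm_clip[of "snd p"] by simp
    then show "\<bar>?F p\<bar> \<le> (2 * G)\<^sup>2" using power_mono[of _ "2 * G" 2] by simp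
  next
    \<comment> \<open>Measurable sets of the restricted space are traces of Borel sets on
      \<open>K\<close>, where \<open>X\<close> takes its values, so the law for Borel sets
      applies.\<close>
    fix A B :: "'a set" assume "A \<in> sets (restrict_space borel K)" and B: "B \<in> sets borel"
    then obtain A' where A': "A' \<in> sets borel" "A = K \<inter> A'" by (auto simp: sets_restrict_space)
    have "{\<omega> \<in> space M. X \<omega> \<in> A \<and> Y i \<omega> \<in> B} = {\<omega> \<in> space M. X \<omega> \<in> A' \<and> Y i \<omega> \<in> B}"
      using X_in A' by auto
    moreover have "(\<integral>\<omega>. indicator A (X \<omega>) * measure (Q (X \<omega>)) B \<partial>M)
        = (\<integral>\<omega>. indicator A' (X \<omega>) * measure (Q (X \<omega>)) B \<partial>M)"
      using X_in A' by (intro Bochner_Integration.integral_cong refl) (auto simp: indicator_def)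
    ultimately show "prob {\<omega> \<in> space M. X \<omega> \<in> A \<and> Y i \<omega> \<in> B}
        = (\<integral>\<omega>. indicator A (X \<omega>) * measure (Q (X \<omega>)) B \<partial>M)"
      using law_single[OF i A'(1) B] by simp
  qed (auto simp: Int_stable_def sets.sigma_sets_eq[of borel, simplified])
  also have "\<dots> \<le> (\<integral>\<omega>. G\<^sup>2 \<partial>M)"
    using clip_variance X_in by (intro integral_mono_AE') auto
  finally show ?thesis by (simp add: prob_space)
qed

text \<open>Conditional independence enters here: the pair is one draw from the product kernel,
  under which the two centred samples are uncorrelated.\<close>

lemma clip_covariance_sample:
  assumes ij: "i < n" "j < n" "i \<noteq> j"
  shows "(\<integral>\<omega>. (clip (Y i \<omega>) - \<mu> (X \<omega>)) \<bullet> (clip (Y j \<omega>) - \<mu> (X \<omega>)) \<partial>M) = 0"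
proof -
  let ?F = "\<lambda>p. (clip (fst (snd p)) - \<mu> (fst p)) \<bullet> (clip (snd (snd p)) - \<mu> (fst p))"
  let ?E = "{a \<times> b |a b. a \<in> sets borel \<and> b \<in> sets borel} :: ('a \<times> 'a) set set"
  note \<mu>[measurable] kernel[measurable]
  have [measurable]: "Y i \<in> borel_measurable M" "Y j \<in> borel_measurable M" using Y ij by auto
  have "(\<integral>\<omega>. ?F (X \<omega>, (Y i \<omega>, Y j \<omega>)) \<partial>M)
    = (\<integral>\<omega>. (\<integral>y. ?F (X \<omega>, y) \<partial>(Q (X \<omega>) \<Otimes>\<^sub>M Q (X \<omega>))) \<partial>M)"
  proof (rule integral_kernel[where S="restrict_space borel K" and T="borel \<Otimes>\<^sub>M borel"
        and \<kappa>="\<lambda>x. Q x \<Otimes>\<^sub>M Q x" and E="?E" and c="(2 * G) * (2 * G)"])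
    show "Int_stable ?E" by (rule Int_stable_pair_measure_generator)
    show "sets (borel \<Otimes>\<^sub>M borel) = sigma_sets (space (borel \<Otimes>\<^sub>M borel)) ?E"
      unfolding sets_pair_measure by (simp add: space_pair_measure)
    show "space (borel \<Otimes>\<^sub>M borel) \<in> ?E"
      by (force simp: space_pair_measure)
    fix p :: "'a \<times> 'a \<times> 'a"
    assume p: "p \<in> space (restrict_space borel K \<Otimes>\<^sub>M borel \<Otimes>\<^sub>M borel)"
    then have "norm (\<mu> (fst p)) \<le> G"
      by (intro norm_\<mu>) (auto simp: space_pair_measure space_restrict_space)
    then have b: "norm (clip y - \<mu> (fst p)) \<le> 2 * G" for y
      using norm_triangle_ineq4[of "clip y" "\<mu> (fst p)"] norm_clip[of y] by simp
    show "\<bar>?F p\<bar> \<le> (2 * G) * (2 * G)"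
      using G by (intro order_trans[OF Cauchy_Schwarz_ineq2] mult_mono b) auto
  next
    fix A :: "'a set" and Z :: "('a \<times> 'a) set"
    assume "A \<in> sets (restrict_space borel K)" and "Z \<in> ?E"
    then obtain A' B C where A': "A' \<in> sets borel" "A = K \<inter> A'"
      and Z: "Z = B \<times> C" and BC: "B \<in> sets borel" "C \<in> sets borel"
      by (auto simp: sets_restrict_space)
    have "{\<omega> \<in> space M. X \<omega> \<in> A \<and> (Y i \<omega>, Y j \<omega>) \<in> Z} = {\<omega> \<in> space M. X \<omega> \<in> A' \<and> (Y i \<omega>, Y j \<omega>) \<in> Z}"
      using X_in A' by auto
    moreover have "(\<integral>\<omega>. indicator A (X \<omega>) * measure (Q (X \<omega>) \<Otimes>\<^sub>M Q (X \<omega>)) Z \<partial>M)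
        = (\<integral>\<omega>. indicator A' (X \<omega>) * measure (Q (X \<omega>) \<Otimes>\<^sub>M Q (X \<omega>)) Z \<partial>M)"
      using X_in A' by (intro Bochner_Integration.integral_cong refl) (auto simp: indicator_def)
    ultimately show "prob {\<omega> \<in> space M. X \<omega> \<in> A \<and> (Y i \<omega>, Y j \<omega>) \<in> Z}
        = (\<integral>\<omega>. indicator A (X \<omega>) * measure (Q (X \<omega>) \<Otimes>\<^sub>M Q (X \<omega>)) Z \<partial>M)"
      using law_pair[OF ij A'(1) BC] by (simp add: Z)
  qed (use X in \<open>measurable, auto simp: space_pair_measure\<close>)
  also have "\<dots> = (\<integral>\<omega>. 0 \<partial>M)"
    by (intro Bochner_Integration.integral_cong refl) (simp add: clip_covariance X_in)
  finally show ?thesis by simp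
qed

section \<open>Error of the batch mean\<close>

lemma sample_mean_bounded:
  assumes n: "n > 0"
  shows "AE \<omega> in M. norm ((1 / real n) *\<^sub>R (\<Sum>i<n. Y i \<omega>) - \<mu> (X \<omega>)) \<le> 2 * G"
proof -
  have "AE \<omega> in M. \<forall>i<n. norm (Y i \<omega>) \<le> G"
    using sample_bounded by (simp add: AE_all_countable AE_ball_countable)
  then show ?thesis
  proof (rule AE_mp, intro AE_I2 impI)
    fix \<omega> assume \<omega>: "\<omega> \<in> space M" and b: "\<forall>i<n. norm (Y i \<omega>) \<le> G"
    have "norm (\<Sum>i<n. Y i \<omega>) \<le> real n * G"
      using sum_norm_bound[of "{..<n}" "\<lambda>i. Y i \<omega>" G] b by auto
    then have "norm ((1 / real n) *\<^sub>R (\<Sum>i<n. Y i \<omega>)) \<le> G"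
      using n by (simp add: field_simps)
    then show "norm ((1 / real n) *\<^sub>R (\<Sum>i<n. Y i \<omega>) - \<mu> (X \<omega>)) \<le> 2 * G"
      using norm_triangle_ineq4[of "(1 / real n) *\<^sub>R (\<Sum>i<n. Y i \<omega>)" "\<mu> (X \<omega>)"]
        norm_\<mu>[OF X_in[OF \<omega>]] by simp
  qed
qed

text \<open>Expanding the square gives a double sum of covariances. The \<open>n\<close> diagonal
  ones are at most \<open>G\<^sup>2\<close> and the others vanish, so dividing by the square of
  \<open>n\<close> leaves \<open>G\<^sup>2 / n\<close>.\<close>

lemma sample_mean_variance:
  assumes n: "n > 0"
  shows "(\<integral>\<omega>. (norm ((1 / real n) *\<^sub>R (\<Sum>i<n. Y i \<omega>) - \<mu> (X \<omega>)))\<^sup>2 \<partial>M) \<le> G\<^sup>2 / real n"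
proof -
  have [measurable]: "i < n \<Longrightarrow> Y i \<in> borel_measurable M" for i by (rule Y)
  let ?e = "\<lambda>i \<omega>. clip (Y i \<omega>) - \<mu> (X \<omega>)"
  have em: "?e i \<in> borel_measurable M" if "i < n" for i using that by measurable
  have eb: "norm (?e i \<omega>) \<le> 2 * G" if "\<omega> \<in> space M" for i \<omega>
    using norm_triangle_ineq4[of "clip (Y i \<omega>)" "\<mu> (X \<omega>)"] norm_clip[of "Y i \<omega>"]
      norm_\<mu>[OF X_in[OF that]] by simp
  have int: "integrable M (\<lambda>\<omega>. ?e i \<omega> \<bullet> ?e j \<omega>)" if "i < n" "j < n" for i j
  proof (rule integrable_const_bound[where B="(2 * G) * (2 * G)"])
    show "AE \<omega> in M. norm (?e i \<omega> \<bullet> ?e j \<omega>) \<le> (2 * G) * (2 * G)"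
      unfolding real_norm_def
      using G by (intro AE_I2 order_trans[OF Cauchy_Schwarz_ineq2] mult_mono eb) auto
  qed (use em that in measurable)
  have "AE \<omega> in M. \<forall>i<n. norm (Y i \<omega>) \<le> G"
    using sample_bounded by (simp add: AE_all_countable AE_ball_countable)
  then have "AE \<omega> in M. (norm ((1 / real n) *\<^sub>R (\<Sum>i<n. Y i \<omega>) - \<mu> (X \<omega>)))\<^sup>2
    = (1 / real n)\<^sup>2 * (\<Sum>i<n. \<Sum>j<n. ?e i \<omega> \<bullet> ?e j \<omega>)"
  proof eventually_elim
    fix \<omega> assume b: "\<forall>i<n. norm (Y i \<omega>) \<le> G"
    have "(1 / real n) *\<^sub>R (\<Sum>i<n. Y i \<omega>) - \<mu> (X \<omega>) = (1 / real n) *\<^sub>R (\<Sum>i<n. Y i \<omega> - \<mu> (X \<omega>))"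
      using n by (simp add: sum_subtractf scaleR_diff_right sum_constant_scaleR)
    also have "(\<Sum>i<n. Y i \<omega> - \<mu> (X \<omega>)) = (\<Sum>i<n. ?e i \<omega>)"
      using b by (intro sum.cong) (auto simp: clip_def)
    finally have eq: "(1 / real n) *\<^sub>R (\<Sum>i<n. Y i \<omega>) - \<mu> (X \<omega>) = (1 / real n) *\<^sub>R (\<Sum>i<n. ?e i \<omega>)" .
    have "(norm (\<Sum>i<n. ?e i \<omega>))\<^sup>2 = (\<Sum>i<n. \<Sum>j<n. ?e i \<omega> \<bullet> ?e j \<omega>)"
      by (subst sum.swap) (simp only: power2_norm_eq_inner inner_sum_left inner_sum_right)
    then show "(norm ((1 / real n) *\<^sub>R (\<Sum>i<n. Y i \<omega>) - \<mu> (X \<omega>)))\<^sup>2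
        = (1 / real n)\<^sup>2 * (\<Sum>i<n. \<Sum>j<n. ?e i \<omega> \<bullet> ?e j \<omega>)"
      unfolding eq norm_scaleR power_mult_distrib real_norm_def power2_abs by simp
  qed
  then have "(\<integral>\<omega>. (norm ((1 / real n) *\<^sub>R (\<Sum>i<n. Y i \<omega>) - \<mu> (X \<omega>)))\<^sup>2 \<partial>M)
    = (\<integral>\<omega>. (1 / real n)\<^sup>2 * (\<Sum>i<n. \<Sum>j<n. ?e i \<omega> \<bullet> ?e j \<omega>) \<partial>M)"
    by (intro integral_cong_AE) (use em in measurable)
  also have "\<dots> = (1 / real n)\<^sup>2 * (\<Sum>i<n. \<Sum>j<n. \<integral>\<omega>. ?e i \<omega> \<bullet> ?e j \<omega> \<partial>M)"
  proof -
    have "(\<integral>\<omega>. (\<Sum>i<n. \<Sum>j<n. ?e i \<omega> \<bullet> ?e j \<omega>) \<partial>M) = (\<Sum>i<n. \<integral>\<omega>. (\<Sum>j<n. ?e i \<omega> \<bullet> ?e j \<omega>) \<partial>M)"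
      by (intro Bochner_Integration.integral_sum Bochner_Integration.integrable_sum int) auto
    also have "\<dots> = (\<Sum>i<n. \<Sum>j<n. \<integral>\<omega>. ?e i \<omega> \<bullet> ?e j \<omega> \<partial>M)"
      by (intro sum.cong refl Bochner_Integration.integral_sum int) auto
    finally show ?thesis by (simp only: integral_mult_right_zero)
  qed
  also have "\<dots> \<le> (1 / real n)\<^sup>2 * (\<Sum>i<n. \<Sum>j<n. if i = j then G\<^sup>2 else 0)"
    using clip_variance_sample clip_covariance_sample
    by (intro mult_left_mono sum_mono) (auto simp: power2_norm_eq_inner)
  also have "\<dots> = G\<^sup>2 / real n"
    using n by (simp add: power2_eq_square)
  finally show ?thesis .
qed

end

section \<open>Arithmetic of the recursion\<close>

text \<open>In the application \<open>k\<close> is \<open>\<alpha> / \<beta>\<close> and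
  \<open>s\<close> the normalised noise. The bounds \<open>k \<le> 46 / 5\<close> and
  \<open>s * k \<le> 2\<close> cross at \<open>s = 5 / 23\<close>. Up to there the first one
  suffices; beyond it, multiplication by \<open>s\<close> makes the second applicable and leaves a
  cubic in \<open>s\<close>.\<close>

lemma first_step_polynomial:
  fixes k s :: real
  assumes "0 < k" "k \<le> 46 / 5" "0 \<le> s" "s \<le> 1 / 2" "s * k \<le> 2"
  shows "k / 2 + 50 / 7 * s\<^sup>2 \<le> 93 / 100 * (16 / 3)"
proof (cases "s \<le> 5 / 23")
  case True
  then have "s\<^sup>2 \<le> (5 / 23)\<^sup>2" using assms(3) by (rule power_mono)
  with assms(2) show ?thesis by (simp add: power2_eq_square)
next
  case False
  then have s: "5 / 23 \<le> s" "s > 0" by auto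
  \<comment> \<open>This gives the secant of the square through the end points \<open>5 / 23\<close>
    and \<open>1 / 2\<close>; applied twice, it reduces the cubic to a linear bound.\<close>
  have "(s - 5 / 23) * (s - 1 / 2) \<le> 0"
    using s assms(4) by (intro mult_nonneg_nonpos) auto
  then have q: "s\<^sup>2 \<le> 33 / 46 * s - 5 / 46" by (simp add: power2_eq_square field_simps)
  have "s ^ 3 = s * s\<^sup>2" by (simp add: power3_eq_cube power2_eq_square)
  also have "\<dots> \<le> s * (33 / 46 * s - 5 / 46)" using q s by (intro mult_left_mono) auto
  also have "\<dots> = 33 / 46 * s\<^sup>2 - 5 / 46 * s" by (simp add: power2_eq_square algebra_simps)
  also have "\<dots> \<le> 33 / 46 * (33 / 46 * s - 5 / 46) - 5 / 46 * s" using q by simp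
  finally have c: "s ^ 3 \<le> 33 / 46 * (33 / 46 * s - 5 / 46) - 5 / 46 * s" .
  have "s * (k / 2 + 50 / 7 * s\<^sup>2) = s * k / 2 + 50 / 7 * s ^ 3"
    by (simp add: power3_eq_cube power2_eq_square algebra_simps)
  also have "\<dots> \<le> s * (93 / 100 * (16 / 3))" using c assms(5) s by (simp add: field_simps)
  finally show ?thesis using s by simp
qed

text \<open>\<open>H\<close> is the expected gap of \<open>x 2\<close>, \<open>D\<close> and
  \<open>d\<close> are the diameters of \<open>K\<close> and \<open>S\<close>, and
  \<open>\<sigma>\<close> is the noise level. \<open>A1\<close> and \<open>A2\<close> come from
  smoothness and serve small \<open>\<alpha> / \<beta>\<close>; \<open>B1\<close> and
  \<open>B2\<close> come from the linear bound and serve large values. \<open>A1\<close> and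
  \<open>B1\<close> keep the noise as \<open>D * \<sigma>\<close>, which fits the first case of
  \<open>alt\<close>; \<open>A2\<close> and \<open>B2\<close> absorb it through growth, for the
  second.\<close>

lemma first_step_arithmetic:
  fixes H \<alpha> \<beta> D d \<sigma> :: real
  assumes pos: "\<alpha> > 0" "\<beta> > 0" "D > 0" and \<sigma>: "0 \<le> \<sigma>" "\<sigma> \<le> \<beta> * D / 2"
    and alt: "\<sigma> \<le> \<beta> * d\<^sup>2 / (2 * D) \<or> \<sigma> \<le> 2 * \<beta>\<^sup>2 * D / \<alpha>"
    and A1: "H \<le> \<beta> * D\<^sup>2 / 2 + D * \<sigma>"
    and A2: "93 / 100 * H \<le> \<beta> * D\<^sup>2 / 2 + 50 / 7 * \<sigma>\<^sup>2 / \<alpha>"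
    and B1: "3 / 4 * H \<le> 4 * (\<beta>\<^sup>2 * D\<^sup>2 / \<alpha>) + \<beta> * d\<^sup>2 / 2 + D * \<sigma>"
    and B2: "H / 2 \<le> (2 * (\<beta> * D)\<^sup>2 + 2 * sqrt 2 * (\<beta> * D) * \<sigma> + \<sigma>\<^sup>2) / \<alpha> + \<beta> * d\<^sup>2 / 2"
  shows "H \<le> 4 / 3 * \<beta> * d\<^sup>2 + 16 / 3 * (\<beta>\<^sup>2 * D\<^sup>2 / \<alpha>)"
proof -
  define k s P where "k = \<alpha> / \<beta>" and "s = \<sigma> / (\<beta> * D)" and "P = \<beta> * D\<^sup>2"
  have k: "k > 0" and P: "P > 0" and s0: "0 \<le> s" using pos \<sigma> by (auto simp: k_def P_def s_def)
  have s2: "s \<le> 1 / 2" using \<sigma> pos by (simp add: s_def field_simps)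
  have C: "\<beta>\<^sup>2 * D\<^sup>2 / \<alpha> = P / k" and \<sigma>2: "\<sigma>\<^sup>2 / \<alpha> = s\<^sup>2 * (P / k)" and \<sigma>1: "\<sigma> = s * (\<beta> * D)"
    using pos by (simp_all add: k_def s_def P_def power2_eq_square field_simps)
  have d0: "0 \<le> \<beta> * d\<^sup>2" using pos by simp
  have Pk: "P / k > 0" "P = k * (P / k)" using P k by simp_all
  consider (hull) "D * \<sigma> \<le> \<beta> * d\<^sup>2 / 2" | (growth) "s * k \<le> 2"
    using alt pos by (auto simp: s_def k_def field_simps power2_eq_square)
  then show ?thesis
  proof cases
    case hull
    show ?thesis
    proof (cases "k \<le> 46 / 5")
      case True
      then have "k * (P / k) \<le> 46 / 5 * (P / k)" using Pk by (intro mult_right_mono) auto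
      then have "P \<le> 46 / 5 * (P / k)" using Pk(2) by simp
      then show ?thesis using A1 hull d0 Pk(1) unfolding C P_def[symmetric] by linarith
    next
      case False
      then show ?thesis using B1 hull d0 unfolding C by linarith
    qed
  next
    case growth
    show ?thesis
    proof (cases "k \<le> 46 / 5")
      case True
      have "93 / 100 * H \<le> (k / 2 + 50 / 7 * s\<^sup>2) * (P / k)"
        using A2 Pk(2) \<sigma>2 unfolding P_def[symmetric] by (simp add: algebra_simps)
      also have "\<dots> \<le> 93 / 100 * (16 / 3) * (P / k)"
        using first_step_polynomial[OF k True s0 s2 growth] Pk(1) by (intro mult_right_mono) auto
      finally show ?thesis using d0 unfolding C by simp
    next
      case False
      then have "s * (46 / 5) \<le> 2" using growth s0 mult_left_mono[of "46 / 5" k s] by simp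
      then have s: "s \<le> 5 / 23" by simp
      have "sqrt 2 \<le> 1415 / 1000" by (rule real_le_lsqrt) (auto simp: power2_eq_square)
      then have a: "sqrt 2 * s \<le> 1415 / 1000 * (5 / 23)" using s s0 by (intro mult_mono) auto
      have b: "s\<^sup>2 \<le> (5 / 23)\<^sup>2" using s s0 by (rule power_mono)
      have "H / 2 \<le> (2 + 2 * (sqrt 2 * s) + s\<^sup>2) * (P / k) + \<beta> * d\<^sup>2 / 2"
      proof -
        have "(2 * (\<beta> * D)\<^sup>2 + 2 * sqrt 2 * (\<beta> * D) * \<sigma> + \<sigma>\<^sup>2) / \<alpha>
            = (2 + 2 * (sqrt 2 * s) + s\<^sup>2) * (\<beta>\<^sup>2 * D\<^sup>2 / \<alpha>)"
          unfolding \<sigma>1 using pos by (simp add: power2_eq_square field_simps)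
        with B2 show ?thesis unfolding C by simp
      qed
      \<comment> \<open>At the extreme value \<open>s = 5 / 23\<close> the bracket is about 2.66,
        just below \<open>8 / 3\<close>.\<close>
      moreover have "(2 + 2 * (sqrt 2 * s) + s\<^sup>2) * (P / k) \<le> 8 / 3 * (P / k)"
        using a b Pk(1) by (intro mult_right_mono) (auto simp: power2_eq_square)
      ultimately show ?thesis using d0 unfolding C by simp
    qed
  qed
qed

text \<open>In the first step this trades a product with the distance to a minimizer for a multiple
  of the squared distance, which growth bounds by the gap.\<close>

lemma weighted_am_gm:
  fixes a b c :: real
  assumes "c > 0" shows "a * b \<le> c * a\<^sup>2 + b\<^sup>2 / (4 * c)"
proof -
  have "0 \<le> (2 * c * a - b)\<^sup>2 / (4 * c)" using assms by simp
  also have "\<dots> = c * a\<^sup>2 + b\<^sup>2 / (4 * c) - a * b"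
    using assms by (simp add: power2_eq_square field_simps)
  finally show ?thesis by simp
qed

lemma sqrt_batch_bound:
  fixes G a n :: real
  assumes "n \<ge> (G * a)\<^sup>2" "G > 0" "a > 0"
  shows "G / sqrt n \<le> 1 / a"
proof -
  have "G * a \<le> sqrt n" using assms by (intro real_le_rsqrt)
  moreover from this have "sqrt n > 0" using assms by (smt (verit) mult_pos_pos)
  ultimately show ?thesis using assms(3) by (simp add: field_simps)
qed

text \<open>This is \<open>ln z \<le> z - 1\<close> at \<open>z = t / (t + 1)\<close>. The increment
  of the logarithm absorbs the cubic error terms of the recursion.\<close>

lemma ln_Suc_bound:
  assumes "t \<ge> 1"
  shows "ln (real t) + 1 / (real t + 1) \<le> ln (real t + 1)"
proof -
  have "ln (real t / (real t + 1)) \<le> real t / (real t + 1) - 1"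
    using assms by (intro ln_le_minus_one) auto
  also have "real t / (real t + 1) - 1 = - (1 / (real t + 1))" by (simp add: field_simps)
  finally show ?thesis using assms by (simp add: ln_div)
qed

text \<open>The left side equals \<open>r / (r + 1)\<^sup>2\<close>, and
  \<open>r * (r + 2) \<le> (r + 1)\<^sup>2\<close>. With \<open>r = t\<close> this is the induction
  step for a term of order \<open>1 / (t + 1)\<close>.\<close>

lemma one_step_arithmetic:
  fixes r :: real
  assumes "r \<ge> 1"
  shows "(1 - 2 / (r + 1)) * (1 / (r + 1)) + 1 / (r + 1)\<^sup>2 \<le> 1 / (r + 2)"
proof -
  have "(1 - 2 / (r + 1)) * (1 / (r + 1)) + 1 / (r + 1)\<^sup>2 = r / (r + 1)\<^sup>2"
    using assms by (simp add: divide_simps power2_eq_square)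
  also have "\<dots> \<le> 1 / (r + 2)"
    using assms by (simp add: divide_simps power2_eq_square) (simp add: algebra_simps)
  finally show ?thesis .
qed

text \<open>Since \<open>(r - 1) * (r + 1) \<le> r\<^sup>2\<close>, the contraction factor moves the
  denominator from \<open>r\<^sup>2\<close> to \<open>(r + 1)\<^sup>2\<close>. Over this denominator
  the cubic term is the increment \<open>1 / (r + 1)\<close> granted to \<open>L'\<close>.\<close>

lemma log_step_arithmetic:
  fixes r :: real
  assumes r: "r \<ge> 1" and L: "0 \<le> L" "L + 1 / (r + 1) \<le> L'"
  shows "(1 - 2 / (r + 1)) * (L / r\<^sup>2) + 1 / (r + 1) ^ 3 \<le> L' / (r + 1)\<^sup>2"
proof -
  have "(1 - 2 / (r + 1)) / r\<^sup>2 \<le> 1 / (r + 1)\<^sup>2"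
    using r by (simp add: divide_simps power2_eq_square) (simp add: algebra_simps)
  from mult_right_mono[OF this L(1)]
  have "(1 - 2 / (r + 1)) * (L / r\<^sup>2) \<le> L / (r + 1)\<^sup>2" by simp
  moreover have "1 / (r + 1) ^ 3 = (1 / (r + 1)) / (r + 1)\<^sup>2"
    by (simp add: power3_eq_cube power2_eq_square)
  moreover have "(L + 1 / (r + 1)) / (r + 1)\<^sup>2 \<le> L' / (r + 1)\<^sup>2"
    using L(2) by (rule divide_right_mono) simp
  ultimately show ?thesis by (simp add: add_divide_distrib)
qed

section \<open>Runs of the algorithm\<close>

text \<open>Batch sizes are only assumed positive, so that the batch mean is a true average; the
  lemmas that need more take bounds on \<open>G / sqrt (m t)\<close> as hypotheses.\<close>

locale nep_frank_wolfe_run = prob_space M for M :: "'w measure" +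
  fixes K S :: "'a::euclidean_space set" and f :: "'a \<Rightarrow> real" and \<alpha> \<beta> G :: real
    and Q :: "'a \<Rightarrow> 'a measure" and m :: "nat \<Rightarrow> nat"
    and x v :: "nat \<Rightarrow> 'w \<Rightarrow> 'a" and g :: "nat \<Rightarrow> nat \<Rightarrow> 'w \<Rightarrow> 'a"
  assumes convex_K: "convex K" and compact_K: "compact K"
    and convex_f: "convex_on K f"
    and \<beta>: "\<beta> > 0" and smooth: "smooth_over \<beta> f K"
    and \<alpha>: "\<alpha> > 0" and growth: "quadratic_growth \<alpha> f K"
    and S: "optimal_hull_set f K S"
    and G: "G > 0" and gradient_oracle: "stochastic_oracle G f K Q"
    and run: "stochastic_nep_frank_wolfe M K \<beta> Q (\<lambda>t. 2 / (real t + 1)) m x g v"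
    and m_pos: "\<And>t. t \<ge> 1 \<Longrightarrow> m t > 0"
begin

definition \<eta> :: "nat \<Rightarrow> real" where "\<eta> t = 2 / (real t + 1)"

definition gap :: "nat \<Rightarrow> 'w \<Rightarrow> real" where "gap t \<omega> = f (x t \<omega>) - min_value f K"

definition err :: "nat \<Rightarrow> 'w \<Rightarrow> real" where
  "err t \<omega> = norm (batch_mean m g t \<omega> - gradient f (x t \<omega>))"

lemma \<eta>_bounds: "t \<ge> 1 \<Longrightarrow> 0 \<le> \<eta> t \<and> \<eta> t \<le> 1"
  by (simp add: \<eta>_def)

lemma extreme_in_K: "u \<in> extreme_points K \<Longrightarrow> u \<in> K"
  by (simp add: extreme_points_def extreme_point_of_def)

lemma
  assumes "t \<ge> 1"
  shows g_measurable: "i < m t \<Longrightarrow> g t i \<in> borel_measurable M"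
    and v_measurable: "v t \<in> borel_measurable M"
    and fresh: "fresh_batch M Q m x g v t"
  using run assms unfolding stochastic_nep_frank_wolfe_def by blast+

lemma
  assumes "t \<ge> 1" "\<omega> \<in> space M"
  shows v_arg_min: "is_arg_min (\<lambda>u. u \<bullet> batch_mean m g t \<omega> + \<beta> * \<eta> t / 2 * (norm (x t \<omega> - u))\<^sup>2)
      (\<lambda>u. u \<in> extreme_points K) (v t \<omega>)"
    and x_Suc: "x (Suc t) \<omega> = (1 - \<eta> t) *\<^sub>R x t \<omega> + \<eta> t *\<^sub>R v t \<omega>"
  using run assms unfolding stochastic_nep_frank_wolfe_def \<eta>_def by simp_all

lemma v_in: "t \<ge> 1 \<Longrightarrow> \<omega> \<in> space M \<Longrightarrow> v t \<omega> \<in> K"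
  using v_arg_min by (simp add: is_arg_min_def extreme_in_K)

lemma v_optimal:
  assumes "t \<ge> 1" "\<omega> \<in> space M" "s \<in> extreme_points K"
  shows "v t \<omega> \<bullet> batch_mean m g t \<omega> + \<beta> * \<eta> t / 2 * (norm (x t \<omega> - v t \<omega>))\<^sup>2
    \<le> s \<bullet> batch_mean m g t \<omega> + \<beta> * \<eta> t / 2 * (norm (x t \<omega> - s))\<^sup>2"
  using v_arg_min[OF assms(1,2)] assms(3) by (auto simp: is_arg_min_def not_less)

lemma obtain_start:
  obtains x1 where "x1 \<in> K" "\<And>\<omega>. \<omega> \<in> space M \<Longrightarrow> x 1 \<omega> = x1"
  using run extreme_in_K unfolding stochastic_nep_frank_wolfe_def by blast

lemma x_in: "t \<ge> 1 \<Longrightarrow> \<omega> \<in> space M \<Longrightarrow> x t \<omega> \<in> K"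
proof (induction t rule: nat_induct_at_least)
  case base
  then show ?case by (metis obtain_start)
next
  case (Suc t)
  then have "x t \<omega> \<in> K" "v t \<omega> \<in> K" by (simp_all add: v_in)
  from convexD[OF convex_K this, of "1 - \<eta> t" "\<eta> t"] show ?case
    using \<eta>_bounds[of t] Suc by (simp add: x_Suc)
qed

lemma K_nonempty: "K \<noteq> {}"
  using obtain_start by blast

lemma continuous_f: "continuous_on K f" and continuous_gradient: "continuous_on K (gradient f)"
  using smooth_over_continuous_on[OF smooth] smooth_over_continuous_on_gradient[OF smooth] \<beta>
  by simp_all

lemma norm_le_diameter: "u \<in> K \<Longrightarrow> w \<in> K \<Longrightarrow> norm (u - w) \<le> diameter K"
  using diameter_bounded_bound[OF compact_imp_bounded[OF compact_K]] by (simp add: dist_norm)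

subsection \<open>Measurability and the error of the averaged gradients\<close>

lemma history_subset: "history M m g v t \<subseteq> sets M"
  unfolding history_def
  by (rule sets.sigma_sets_subset) (auto intro!: measurable_sets g_measurable v_measurable)

text \<open>The iterates do not generate the history, but \<open>x 1\<close> is constant and
  \<open>x (Suc s)\<close> is a combination of \<open>x s\<close> and \<open>v s\<close>. As
  \<open>v s\<close> is listed for \<open>s < t\<close>, measurability reaches
  \<open>x t\<close>.\<close>

lemma x_history:
  assumes "1 \<le> s" "s \<le> t" "C \<in> sets borel"
  shows "x s -` C \<inter> space M \<in> history M m g v t"
proof -
  let ?G = "{g s i -` B \<inter> space M | s i B. 1 \<le> s \<and> s < t \<and> i < m s \<and> B \<in> sets borel} \<union>
      {v s -` B \<inter> space M | s B. 1 \<le> s \<and> s < t \<and> B \<in> sets borel}"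
  define H where "H = sigma (space M) ?G"
  have "?G \<subseteq> Pow (space M)" by auto
  then have H: "space H = space M" "sets H = history M m g v t"
    unfolding H_def history_def by (simp_all add: space_measure_of sets_measure_of)
  have v: "v s \<in> borel_measurable H" if "1 \<le> s" "s < t" for s
    by (rule measurableI) (use that in \<open>auto simp: H history_def intro!: sigma_sets.Basic\<close>)
  have "x s \<in> borel_measurable H" if "1 \<le> s" "s \<le> t" for s
    using that
  proof (induction s rule: nat_induct_at_least)
    case base
    obtain x1 where "\<And>\<omega>. \<omega> \<in> space M \<Longrightarrow> x 1 \<omega> = x1" using obtain_start by blast
    then have "x 1 \<in> borel_measurable H \<longleftrightarrow> (\<lambda>_. x1) \<in> borel_measurable H"
      by (intro measurable_cong) (simp add: H)
    then show ?case by simp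
  next
    case (Suc s)
    then have "(\<lambda>\<omega>. (1 - \<eta> s) *\<^sub>R x s \<omega> + \<eta> s *\<^sub>R v s \<omega>) \<in> borel_measurable H"
      using v[of s] by (intro borel_measurable_add borel_measurable_scaleR) auto
    moreover have "x (Suc s) \<in> borel_measurable H
        \<longleftrightarrow> (\<lambda>\<omega>. (1 - \<eta> s) *\<^sub>R x s \<omega> + \<eta> s *\<^sub>R v s \<omega>) \<in> borel_measurable H"
      using Suc.hyps by (intro measurable_cong) (simp add: H x_Suc)
    ultimately show ?case by blast
  qed
  from measurable_sets[OF this[OF assms(1,2)] assms(3)] show ?thesis by (simp add: H)
qed

lemma x_measurable: "t \<ge> 1 \<Longrightarrow> x t \<in> M \<rightarrow>\<^sub>M restrict_space borel K"
  using x_history[of t t] history_subset x_in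
  by (intro measurable_restrict_space2 measurableI) auto

text \<open>Freshness is applied to the history events that the current iterate lies in a Borel
  set.\<close>

lemma batch_conditional_sample:
  assumes t: "t \<ge> 1"
  shows "conditional_sample M K Q (x t) (g t) (m t) G (gradient f)"
proof
  show "Q \<in> restrict_space borel K \<rightarrow>\<^sub>M prob_algebra borel"
    and "\<And>u. u \<in> K \<Longrightarrow> AE y in Q u. norm y \<le> G"
    and "\<And>u. u \<in> K \<Longrightarrow> (\<integral>y. y \<partial>Q u) = gradient f u"
    using gradient_oracle unfolding stochastic_oracle_def by auto
  show "x t \<in> M \<rightarrow>\<^sub>M restrict_space borel K" by (rule x_measurable[OF t])
  show "gradient f \<in> borel_measurable (restrict_space borel K)"
    by (rule borel_measurable_continuous_on_restrict[OF continuous_gradient])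
  fix A :: "'a set" and B :: "nat \<Rightarrow> 'a set"
  assume A: "A \<in> sets borel" and B: "\<And>i. i < m t \<Longrightarrow> B i \<in> sets borel"
  let ?A = "x t -` A \<inter> space M"
  have "{\<omega> \<in> space M. x t \<omega> \<in> A \<and> (\<forall>i<m t. g t i \<omega> \<in> B i)}
      = ?A \<inter> {\<omega> \<in> space M. \<forall>i<m t. g t i \<omega> \<in> B i}" by auto
  also have "prob \<dots> = (\<integral>\<omega>. indicator ?A \<omega> * (\<Prod>i<m t. measure (Q (x t \<omega>)) (B i)) \<partial>M)"
    using fresh[OF t] x_history[OF t order_refl A] B unfolding fresh_batch_def by blast
  also have "\<dots> = (\<integral>\<omega>. indicator A (x t \<omega>) * (\<Prod>i<m t. measure (Q (x t \<omega>)) (B i)) \<partial>M)"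
    by (intro Bochner_Integration.integral_cong refl) (auto simp: indicator_def)
  finally show "prob {\<omega> \<in> space M. x t \<omega> \<in> A \<and> (\<forall>i<m t. g t i \<omega> \<in> B i)}
      = (\<integral>\<omega>. indicator A (x t \<omega>) * (\<Prod>i<m t. measure (Q (x t \<omega>)) (B i)) \<partial>M)" .
qed (use G g_measurable t in auto)

lemma gap_integrable:
  assumes t: "t \<ge> 1" shows "integrable M (gap t)"
proof -
  have "compact (f ` K)" by (rule compact_continuous_image[OF continuous_f compact_K])
  then obtain B where B: "\<And>u. u \<in> K \<Longrightarrow> norm (f u) \<le> B"
    by (meson bounded_iff compact_imp_bounded imageI)
  have "(\<lambda>\<omega>. f (x t \<omega>)) \<in> borel_measurable M"
    using measurable_compose[OF x_measurable[OF t]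
        borel_measurable_continuous_on_restrict[OF continuous_f]] .
  then have "integrable M (\<lambda>\<omega>. f (x t \<omega>))"
    using B x_in[OF t] by (intro integrable_const_bound[where B=B]) auto
  then show ?thesis unfolding gap_def by simp
qed

text \<open>The almost sure bound \<open>2 * G\<close> serves integrability; the size comes from the
  variance of the batch mean. The second moment is kept because the first step uses it too.\<close>

lemma
  assumes t: "t \<ge> 1"
  shows err_integrable: "integrable M (err t)"
    and err_square_integrable: "integrable M (\<lambda>\<omega>. (err t \<omega>)\<^sup>2)"
    and err_square_bound: "(\<integral>\<omega>. (err t \<omega>)\<^sup>2 \<partial>M) \<le> (G / sqrt (m t))\<^sup>2"
    and err_bound: "(\<integral>\<omega>. err t \<omega> \<partial>M) \<le> G / sqrt (m t)"
proof -
  interpret B: conditional_sample M K Q "x t" "g t" "m t" G "gradient f"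
    by (rule batch_conditional_sample[OF t])
  have meas: "err t \<in> borel_measurable M"
    unfolding err_def batch_mean_def
    by (intro measurable_compose[OF _ borel_measurable_norm] borel_measurable_diff borel_measurable_scaleR
        borel_measurable_sum B.\<mu>_X) (auto intro: g_measurable t)
  have AE: "AE \<omega> in M. err t \<omega> \<le> 2 * G"
    using B.sample_mean_bounded[OF m_pos[OF t]] by (simp add: err_def batch_mean_def)
  show int: "integrable M (err t)"
    by (rule integrable_const_bound[where B="2 * G"]) (use AE meas in \<open>auto simp: err_def\<close>)
  show sq: "integrable M (\<lambda>\<omega>. (err t \<omega>)\<^sup>2)"
  proof (rule integrable_const_bound[where B="(2 * G)\<^sup>2"])
    show "AE \<omega> in M. norm ((err t \<omega>)\<^sup>2) \<le> (2 * G)\<^sup>2"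
      using AE
    proof eventually_elim
      case (elim \<omega>)
      then have "(err t \<omega>)\<^sup>2 \<le> (2 * G)\<^sup>2" by (rule power_mono) (simp add: err_def)
      then show ?case by simp
    qed
  qed (use meas in measurable)
  show sqb: "(\<integral>\<omega>. (err t \<omega>)\<^sup>2 \<partial>M) \<le> (G / sqrt (m t))\<^sup>2"
    using B.sample_mean_variance[OF m_pos[OF t]]
    by (simp add: err_def batch_mean_def power_divide)
  \<comment> \<open>Jensen's inequality for the square, in the form of a nonnegative
    variance.\<close>
  have "variance (err t) \<ge> 0" by (rule variance_positive)
  then have "(expectation (err t))\<^sup>2 \<le> (G / sqrt (m t))\<^sup>2"
    using variance_eq[OF int sq] sqb by simp
  then show "(\<integral>\<omega>. err t \<omega> \<partial>M) \<le> G / sqrt (m t)"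
    by (rule power2_le_imp_le) (use G in simp)
qed

subsection \<open>Progress of one iteration\<close>

lemma S_subset: "S \<subseteq> extreme_points K" and minimizers_hull: "minimizers f K \<subseteq> convex hull S"
  using S unfolding optimal_hull_set_def is_arg_min_def by auto

lemma S_K: "S \<subseteq> K"
  using S_subset extreme_in_K by blast

lemma minimizer_in: "y \<in> minimizers f K \<Longrightarrow> y \<in> K"
  by (simp add: minimizers_iff)

text \<open>The minimizers form a nonempty closed set, so the distance in the growth condition is
  attained.\<close>

lemma near_minimizer:
  assumes "t \<ge> 1" "\<omega> \<in> space M"
  obtains y where "y \<in> minimizers f K" "(norm (x t \<omega> - y))\<^sup>2 \<le> 2 / \<alpha> * gap t \<omega>"
proof -
  obtain y where y: "y \<in> minimizers f K" "infdist (x t \<omega>) (minimizers f K) = dist (x t \<omega>) y"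
    using infdist_attains_inf[OF minimizers_closed[OF compact_K continuous_f]
        minimizers_nonempty[OF compact_K K_nonempty continuous_f]] by blast
  have "(infdist (x t \<omega>) (minimizers f K))\<^sup>2 \<le> 2 / \<alpha> * gap t \<omega>"
    using growth x_in[OF assms] by (simp add: quadratic_growth_def gap_def)
  with y show ?thesis by (intro that) (auto simp: dist_norm)
qed

lemma v_near_hull:
  assumes t: "t \<ge> 1" "\<omega> \<in> space M" and y: "y \<in> minimizers f K"
  shows "v t \<omega> \<bullet> batch_mean m g t \<omega> + \<beta> * \<eta> t / 2 * (norm (x t \<omega> - v t \<omega>))\<^sup>2
    \<le> y \<bullet> batch_mean m g t \<omega> + \<beta> * \<eta> t / 2 * ((norm (x t \<omega> - y))\<^sup>2 + (diameter S)\<^sup>2)"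
proof (rule nearest_extreme_point_hull)
  have "bounded S" using S_K compact_K bounded_subset compact_imp_bounded by blast
  then show "norm (s - y) \<le> diameter S" if "s \<in> S" for s
    using that y minimizers_hull by (intro hull_dist_le_diameter) auto
  show "y \<in> convex hull S" using y minimizers_hull by blast
  show "0 \<le> \<beta> * \<eta> t" using \<beta> \<eta>_bounds t by simp
qed (use v_optimal[OF t] S_subset in blast)

lemma v_near_diameter:
  assumes t: "t \<ge> 1" "\<omega> \<in> space M" and y: "y \<in> minimizers f K"
  shows "v t \<omega> \<bullet> batch_mean m g t \<omega> + \<beta> * \<eta> t / 2 * (norm (x t \<omega> - v t \<omega>))\<^sup>2
    \<le> y \<bullet> batch_mean m g t \<omega> + \<beta> * \<eta> t / 2 * (diameter K)\<^sup>2"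
proof (rule nearest_extreme_point_hull_diameter)
  show "norm (x t \<omega> - s) \<le> diameter K" if "s \<in> S" for s
    using that S_K x_in[OF t] norm_le_diameter by blast
  show "y \<in> convex hull S" using y minimizers_hull by blast
  show "0 \<le> \<beta> * \<eta> t" using \<beta> \<eta>_bounds t by simp
qed (use v_optimal[OF t] S_subset in blast)

lemma gap_step:
  assumes t: "t \<ge> 1" "\<omega> \<in> space M" and y: "y \<in> minimizers f K"
    and W: "v t \<omega> \<bullet> batch_mean m g t \<omega> + \<beta> * \<eta> t / 2 * (norm (x t \<omega> - v t \<omega>))\<^sup>2
      \<le> y \<bullet> batch_mean m g t \<omega> + \<beta> * \<eta> t / 2 * W"
  shows "gap (Suc t) \<omega> \<le> (1 - \<eta> t) * gap t \<omega> + \<beta> * (\<eta> t)\<^sup>2 / 2 * W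
    + \<eta> t * (norm (v t \<omega> - y) * err t \<omega>)"
  using frank_wolfe_step[OF smooth convex_K convex_f x_in[OF t] v_in[OF t] minimizer_in[OF y] _ _ W]
    \<eta>_bounds[OF t(1)]
  by (simp add: gap_def err_def x_Suc[OF t] minimizers_min_value[OF y])

lemma gap_step_noise:
  assumes t: "t \<ge> 1" "\<omega> \<in> space M" and y: "y \<in> minimizers f K"
  shows "\<eta> t * (norm (v t \<omega> - y) * err t \<omega>) \<le> \<eta> t * (diameter K * err t \<omega>)"
  using \<eta>_bounds[OF t(1)] norm_le_diameter[OF v_in[OF t] minimizer_in[OF y]]
  by (intro mult_left_mono mult_right_mono) (auto simp: err_def)

lemma expected_gap_step_diameter:
  assumes t: "t \<ge> 1"
  shows "expectation (gap (Suc t)) \<le> (1 - \<eta> t) * expectation (gap t)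
    + \<beta> * (\<eta> t)\<^sup>2 / 2 * (diameter K)\<^sup>2 + \<eta> t * (diameter K * (G / sqrt (m t)))"
proof -
  let ?D = "diameter K"
  have D: "?D \<ge> 0" by (rule diameter_ge_0[OF compact_imp_bounded[OF compact_K]])
  have "expectation (gap (Suc t))
    \<le> (\<integral>\<omega>. (1 - \<eta> t) * gap t \<omega> + \<beta> * (\<eta> t)\<^sup>2 / 2 * ?D\<^sup>2 + \<eta> t * (?D * err t \<omega>) \<partial>M)"
  proof (intro integral_mono)
    fix \<omega> assume \<omega>: "\<omega> \<in> space M"
    obtain y where "y \<in> minimizers f K"
      using minimizers_nonempty[OF compact_K K_nonempty continuous_f] by blast
    from gap_step[OF t \<omega> this v_near_diameter[OF t \<omega> this]] gap_step_noise[OF t \<omega> this]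
    show "gap (Suc t) \<omega> \<le> (1 - \<eta> t) * gap t \<omega> + \<beta> * (\<eta> t)\<^sup>2 / 2 * ?D\<^sup>2 + \<eta> t * (?D * err t \<omega>)"
      by linarith
  qed (use gap_integrable err_integrable t in auto)
  also have "\<dots> = (1 - \<eta> t) * expectation (gap t) + \<beta> * (\<eta> t)\<^sup>2 / 2 * ?D\<^sup>2
      + \<eta> t * (?D * expectation (err t))"
    using gap_integrable[OF t] err_integrable[OF t] by (simp add: prob_space)
  also have "\<eta> t * (?D * expectation (err t)) \<le> \<eta> t * (?D * (G / sqrt (m t)))"
    using \<eta>_bounds[OF t] D err_bound[OF t] by (intro mult_left_mono) auto
  finally show ?thesis by simp
qed

text \<open>The minimizer near the iterate varies with the outcome. Growth removes it from the
  pointwise bound before integration, so no measurable selection is required.\<close>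

lemma expected_gap_step_hull:
  assumes t: "t \<ge> 1"
  shows "expectation (gap (Suc t)) \<le> (1 - \<eta> t) * expectation (gap t)
    + \<beta> * (\<eta> t)\<^sup>2 / 2 * (2 / \<alpha> * expectation (gap t) + (diameter S)\<^sup>2)
    + \<eta> t * (diameter K * (G / sqrt (m t)))"
proof -
  let ?D = "diameter K" and ?d = "diameter S"
  have D: "?D \<ge> 0" by (rule diameter_ge_0[OF compact_imp_bounded[OF compact_K]])
  have "expectation (gap (Suc t))
    \<le> (\<integral>\<omega>. (1 - \<eta> t) * gap t \<omega> + \<beta> * (\<eta> t)\<^sup>2 / 2 * (2 / \<alpha> * gap t \<omega> + ?d\<^sup>2)
        + \<eta> t * (?D * err t \<omega>) \<partial>M)"
  proof (intro integral_mono)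
    fix \<omega> assume \<omega>: "\<omega> \<in> space M"
    obtain y where y: "y \<in> minimizers f K" "(norm (x t \<omega> - y))\<^sup>2 \<le> 2 / \<alpha> * gap t \<omega>"
      using near_minimizer[OF t \<omega>] .
    have "\<beta> * (\<eta> t)\<^sup>2 / 2 * ((norm (x t \<omega> - y))\<^sup>2 + ?d\<^sup>2)
        \<le> \<beta> * (\<eta> t)\<^sup>2 / 2 * (2 / \<alpha> * gap t \<omega> + ?d\<^sup>2)"
      using \<beta> y(2) by (intro mult_left_mono) auto
    with gap_step[OF t \<omega> y(1) v_near_hull[OF t \<omega> y(1)]] gap_step_noise[OF t \<omega> y(1)]
    show "gap (Suc t) \<omega> \<le> (1 - \<eta> t) * gap t \<omega> + \<beta> * (\<eta> t)\<^sup>2 / 2 * (2 / \<alpha> * gap t \<omega> + ?d\<^sup>2)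
        + \<eta> t * (?D * err t \<omega>)"
      by linarith
  qed (use gap_integrable err_integrable t in auto)
  also have "\<dots> = (1 - \<eta> t) * expectation (gap t)
      + \<beta> * (\<eta> t)\<^sup>2 / 2 * (2 / \<alpha> * expectation (gap t) + ?d\<^sup>2) + \<eta> t * (?D * expectation (err t))"
    using gap_integrable[OF t] err_integrable[OF t] by (simp add: prob_space)
  also have "\<eta> t * (?D * expectation (err t)) \<le> \<eta> t * (?D * (G / sqrt (m t)))"
    using \<eta>_bounds[OF t] D err_bound[OF t] by (intro mult_left_mono) auto
  finally show ?thesis by simp
qed

subsection \<open>The first step and the recursion\<close>

text \<open>
  The general recursion needs a bound on the distance from \<open>x t\<close> to the minimizers, which quadratic
  growth provides through the gap. In the first round the gap may be arbitrarily large compared to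
  \<open>\<beta> * (diameter K)\<^sup>2\<close> (\<open>f\<close> may be steep), so growth is used at the new point instead: the
  gap there is bounded by a multiple of its distance to the minimizers.
\<close>

lemma expected_first_gap:
  assumes D: "diameter K > 0" and noise: "G / sqrt (m 1) \<le> \<beta> * diameter K / 2"
    and alt: "G / sqrt (m 1) \<le> \<beta> * (diameter S)\<^sup>2 / (2 * diameter K)
      \<or> G / sqrt (m 1) \<le> 2 * \<beta>\<^sup>2 * diameter K / \<alpha>"
  shows "expectation (gap 2)
    \<le> 4 / 3 * \<beta> * (diameter S)\<^sup>2 + 16 / 3 * (\<beta>\<^sup>2 * (diameter K)\<^sup>2 / \<alpha>)"
proof -
  let ?D = "diameter K" and ?d = "diameter S" and ?\<sigma> = "G / sqrt (m 1)"
  have pointwise: "gap 2 \<omega> \<le> \<beta> * ?D\<^sup>2 / 2 + ?D * err 1 \<omega>" (is ?A1)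
    "93 / 100 * gap 2 \<omega> \<le> \<beta> * ?D\<^sup>2 / 2 + 50 / 7 * (err 1 \<omega>)\<^sup>2 / \<alpha>" (is ?A2)
    "3 / 4 * gap 2 \<omega> \<le> 4 * (\<beta>\<^sup>2 * ?D\<^sup>2 / \<alpha>) + \<beta> * ?d\<^sup>2 / 2 + ?D * err 1 \<omega>" (is ?B1)
    "gap 2 \<omega> / 2 \<le> (2 * (\<beta> * ?D)\<^sup>2 + 2 * sqrt 2 * (\<beta> * ?D) * err 1 \<omega> + (err 1 \<omega>)\<^sup>2) / \<alpha>
      + \<beta> * ?d\<^sup>2 / 2" (is ?B2)
    if \<omega>: "\<omega> \<in> space M" for \<omega>
  proof -
    \<comment> \<open>With a full first step, \<open>x 2\<close> is the oracle's answer itself and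
      the gap of \<open>x 1\<close> drops out.\<close>
    have \<eta>1: "\<eta> 1 = 1" by (simp add: \<eta>_def)
    have x2: "x 2 \<omega> = v 1 \<omega>" using x_Suc[OF order_refl \<omega>] \<eta>1 by (simp add: numeral_2_eq_2)
    obtain y where y: "y \<in> minimizers f K" "(norm (x 2 \<omega> - y))\<^sup>2 \<le> 2 / \<alpha> * gap 2 \<omega>"
      using near_minimizer[of 2 \<omega>] \<omega> by auto
    define \<delta> e where "\<delta> = norm (v 1 \<omega> - y)" and "e = err 1 \<omega>"
    have e: "0 \<le> e" by (simp add: e_def err_def)
    have \<delta>: "0 \<le> \<delta>" "\<delta> \<le> ?D"
      using norm_le_diameter[OF v_in[OF _ \<omega>] minimizer_in[OF y(1)]] by (auto simp: \<delta>_def)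
    have \<delta>e: "\<delta> * e \<le> ?D * e" using \<delta> e by (intro mult_right_mono)
    have growth: "\<alpha> * \<delta>\<^sup>2 \<le> 2 * gap 2 \<omega>"
      using y(2) \<alpha> by (simp add: x2 \<delta>_def field_simps)
    have A: "gap 2 \<omega> \<le> \<beta> * ?D\<^sup>2 / 2 + \<delta> * e"
      using gap_step[OF order_refl \<omega> y(1) v_near_diameter[OF order_refl \<omega> y(1)]] \<eta>1
      by (simp add: \<delta>_def e_def numeral_2_eq_2)
    have "f (v 1 \<omega>) - f y \<le> sqrt 2 * \<beta> * ?D * norm (v 1 \<omega> - y) + \<beta> / 2 * ?d\<^sup>2
        + norm (v 1 \<omega> - y) * norm (batch_mean m g 1 \<omega> - gradient f (x 1 \<omega>))"
      using v_near_hull[OF order_refl \<omega> y(1)] \<eta>1 \<beta>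
      by (intro full_step_linear_bound[OF smooth convex_K convex_f] norm_le_diameter x_in v_in
          minimizer_in y \<omega>) auto
    then have B: "gap 2 \<omega> \<le> sqrt 2 * (\<beta> * ?D) * \<delta> + \<beta> * ?d\<^sup>2 / 2 + \<delta> * e"
      using minimizers_min_value[OF y(1)] by (simp add: gap_def x2 \<delta>_def e_def err_def mult_ac)
    show ?A1 using A \<delta>e by (simp add: e_def)
    \<comment> \<open>Growth turns the weight \<open>7 / 200\<close> into \<open>7 / 100\<close> of
      the gap, leaving \<open>93 / 100\<close> on the left.\<close>
    have "\<delta> * e \<le> (7 / 200 * \<alpha>) * \<delta>\<^sup>2 + e\<^sup>2 / (4 * (7 / 200 * \<alpha>))"
      by (rule weighted_am_gm) (use \<alpha> in simp)
    also have "\<dots> = 7 / 200 * (\<alpha> * \<delta>\<^sup>2) + 50 / 7 * e\<^sup>2 / \<alpha>" by simp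
    finally show ?A2 using A growth by (simp add: e_def)
    \<comment> \<open>Only the deterministic part is traded here, at the price of a quarter of the
      gap; the noise stays linear.\<close>
    have "\<delta> * (sqrt 2 * (\<beta> * ?D))
        \<le> (1 / 8 * \<alpha>) * \<delta>\<^sup>2 + (sqrt 2 * (\<beta> * ?D))\<^sup>2 / (4 * (1 / 8 * \<alpha>))"
      by (rule weighted_am_gm) (use \<alpha> in simp)
    also have "\<dots> = 1 / 8 * (\<alpha> * \<delta>\<^sup>2) + 4 * (\<beta>\<^sup>2 * ?D\<^sup>2 / \<alpha>)" by (simp add: power_mult_distrib)
    finally show ?B1 using B growth \<delta>e by (simp add: e_def mult_ac)
    \<comment> \<open>Now both parts are traded together, at the price of half the gap.\<close>
    have "sqrt 2 * (\<beta> * ?D) * \<delta> + \<delta> * e = \<delta> * (sqrt 2 * (\<beta> * ?D) + e)"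
      by (simp add: algebra_simps)
    also have "\<dots> \<le> (1 / 4 * \<alpha>) * \<delta>\<^sup>2 + (sqrt 2 * (\<beta> * ?D) + e)\<^sup>2 / (4 * (1 / 4 * \<alpha>))"
      by (rule weighted_am_gm) (use \<alpha> in simp)
    also have "\<dots> = 1 / 4 * (\<alpha> * \<delta>\<^sup>2)
        + (2 * (\<beta> * ?D)\<^sup>2 + 2 * sqrt 2 * (\<beta> * ?D) * e + e\<^sup>2) / \<alpha>"
      by (simp add: power2_sum power_mult_distrib mult_ac)
    finally show ?B2 using B growth unfolding e_def by linarith
  qed
  note [simp] = gap_integrable err_integrable err_square_integrable prob_space
  have Ee: "expectation (err 1) \<le> ?\<sigma>" and Ee2: "expectation (\<lambda>\<omega>. (err 1 \<omega>)\<^sup>2) \<le> ?\<sigma>\<^sup>2"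
    using err_bound[OF order_refl] err_square_bound[OF order_refl] .
  show ?thesis
  proof (rule first_step_arithmetic[OF \<alpha> \<beta> D _ noise alt])
    show "0 \<le> ?\<sigma>" using G by simp
    have DEe: "?D * expectation (err 1) \<le> ?D * ?\<sigma>" using Ee D by (intro mult_left_mono) auto
    have "expectation (gap 2) \<le> (\<integral>\<omega>. \<beta> * ?D\<^sup>2 / 2 + ?D * err 1 \<omega> \<partial>M)"
      by (intro integral_mono pointwise) auto
    also have "\<dots> = \<beta> * ?D\<^sup>2 / 2 + ?D * expectation (err 1)" by simp
    finally show "expectation (gap 2) \<le> \<beta> * ?D\<^sup>2 / 2 + ?D * ?\<sigma>" using DEe by linarith
    have "expectation (\<lambda>\<omega>. 93 / 100 * gap 2 \<omega>)
        \<le> (\<integral>\<omega>. \<beta> * ?D\<^sup>2 / 2 + 50 / 7 * (err 1 \<omega>)\<^sup>2 / \<alpha> \<partial>M)"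
      by (intro integral_mono pointwise) auto
    also have "\<dots> = \<beta> * ?D\<^sup>2 / 2 + 50 / 7 * expectation (\<lambda>\<omega>. (err 1 \<omega>)\<^sup>2) / \<alpha>" by simp
    also have "50 / 7 * expectation (\<lambda>\<omega>. (err 1 \<omega>)\<^sup>2) / \<alpha> \<le> 50 / 7 * ?\<sigma>\<^sup>2 / \<alpha>"
      using Ee2 \<alpha> by (intro divide_right_mono mult_left_mono) auto
    finally show "93 / 100 * expectation (gap 2) \<le> \<beta> * ?D\<^sup>2 / 2 + 50 / 7 * ?\<sigma>\<^sup>2 / \<alpha>" by simp
    have "3 / 4 * expectation (gap 2) = expectation (\<lambda>\<omega>. 3 / 4 * gap 2 \<omega>)" by simp
    also have "\<dots> \<le> (\<integral>\<omega>. 4 * (\<beta>\<^sup>2 * ?D\<^sup>2 / \<alpha>) + \<beta> * ?d\<^sup>2 / 2 + ?D * err 1 \<omega> \<partial>M)"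
      by (intro integral_mono pointwise) auto
    also have "\<dots> = 4 * (\<beta>\<^sup>2 * ?D\<^sup>2 / \<alpha>) + \<beta> * ?d\<^sup>2 / 2 + ?D * expectation (err 1)" by simp
    finally show "3 / 4 * expectation (gap 2)
        \<le> 4 * (\<beta>\<^sup>2 * ?D\<^sup>2 / \<alpha>) + \<beta> * ?d\<^sup>2 / 2 + ?D * ?\<sigma>" using DEe by linarith
    have "expectation (\<lambda>\<omega>. gap 2 \<omega> / 2)
        \<le> (\<integral>\<omega>. (2 * (\<beta> * ?D)\<^sup>2 + 2 * sqrt 2 * (\<beta> * ?D) * err 1 \<omega> + (err 1 \<omega>)\<^sup>2) / \<alpha>
          + \<beta> * ?d\<^sup>2 / 2 \<partial>M)"
      by (intro integral_mono pointwise) auto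
    also have "\<dots> = (2 * (\<beta> * ?D)\<^sup>2 + 2 * sqrt 2 * (\<beta> * ?D) * expectation (err 1)
          + expectation (\<lambda>\<omega>. (err 1 \<omega>)\<^sup>2)) / \<alpha> + \<beta> * ?d\<^sup>2 / 2" by simp
    also have "\<dots> \<le> (2 * (\<beta> * ?D)\<^sup>2 + 2 * sqrt 2 * (\<beta> * ?D) * ?\<sigma> + ?\<sigma>\<^sup>2) / \<alpha> + \<beta> * ?d\<^sup>2 / 2"
      using Ee Ee2 \<alpha> \<beta> D by (intro add_mono divide_right_mono mult_left_mono) auto
    finally show "expectation (gap 2) / 2
        \<le> (2 * (\<beta> * ?D)\<^sup>2 + 2 * sqrt 2 * (\<beta> * ?D) * ?\<sigma> + ?\<sigma>\<^sup>2) / \<alpha> + \<beta> * ?d\<^sup>2 / 2" by simp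
  qed
qed

text \<open>Curvature and noise each add at most
  \<open>2 * (\<beta> * (diameter K)\<^sup>2) / (t + 1)\<^sup>2\<close>. The induction starts at 2,
  where the factor \<open>1 - \<eta> 1 = 0\<close> has already removed the unknown gap of
  \<open>x 1\<close>.\<close>

lemma expected_gap_diameter:
  assumes noise: "\<And>t. t \<ge> 1 \<Longrightarrow> G / sqrt (m t) \<le> \<beta> * diameter K / (real t + 1)"
    and "t \<ge> 2"
  shows "expectation (gap t) \<le> 4 * (\<beta> * (diameter K)\<^sup>2) / (real t + 1)"
proof -
  let ?D = "diameter K"
  have D: "?D \<ge> 0" by (rule diameter_ge_0[OF compact_imp_bounded[OF compact_K]])
  have step: "expectation (gap (Suc t))
      \<le> (1 - \<eta> t) * expectation (gap t) + 4 * (\<beta> * ?D\<^sup>2) * (1 / (real t + 1)\<^sup>2)" if "t \<ge> 1" for t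
  proof -
    have "\<eta> t * (?D * (G / sqrt (m t))) \<le> \<eta> t * (?D * (\<beta> * ?D / (real t + 1)))"
      using \<eta>_bounds[OF that] D noise[OF that] by (intro mult_left_mono) auto
    also have "\<dots> = 2 * (\<beta> * ?D\<^sup>2) * (1 / (real t + 1)\<^sup>2)"
      by (simp add: \<eta>_def power2_eq_square)
    finally show ?thesis
      using expected_gap_step_diameter[OF that] by (simp add: \<eta>_def power2_eq_square)
  qed
  show ?thesis using \<open>t \<ge> 2\<close>
  proof (induction t rule: nat_induct_at_least)
    case base
    have "\<beta> * ?D\<^sup>2 \<ge> 0" using \<beta> by simp
    moreover have "expectation (gap 2) \<le> \<beta> * ?D\<^sup>2"
      using step[of 1] by (simp add: \<eta>_def numeral_2_eq_2)
    ultimately show ?case by simp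
  next
    case (Suc t)
    have t: "t \<ge> 1" using Suc.hyps by simp
    have "(1 - \<eta> t) * expectation (gap t) \<le> (1 - \<eta> t) * (4 * (\<beta> * ?D\<^sup>2) / (real t + 1))"
      using \<eta>_bounds[of t] Suc by (intro mult_left_mono) auto
    also have "\<dots> = 4 * (\<beta> * ?D\<^sup>2) * ((1 - 2 / (real t + 1)) * (1 / (real t + 1)))"
      by (simp add: \<eta>_def)
    finally have "expectation (gap (Suc t))
      \<le> 4 * (\<beta> * ?D\<^sup>2) * ((1 - 2 / (real t + 1)) * (1 / (real t + 1)) + 1 / (real t + 1)\<^sup>2)"
      using step[OF t] by (simp only: distrib_left)
    also have "\<dots> \<le> 4 * (\<beta> * ?D\<^sup>2) * (1 / (real t + 2))"
      using \<beta> Suc.hyps by (intro mult_left_mono one_step_arithmetic) auto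
    finally show ?case by (simp add: add.commute)
  qed
qed

text \<open>The recursion splits into a part of order \<open>1 / (t + 1)\<close> carried by
  \<open>diameter S\<close> and a part with logarithm carried by \<open>diameter K\<close>; each is
  closed by its own arithmetic step.\<close>

lemma expected_gap_bound:
  assumes D: "diameter K > 0"
    and noise: "\<And>t. t \<ge> 1 \<Longrightarrow> G / sqrt (m t) \<le> \<beta> * diameter K / (real t + 1)"
    and alt: "\<And>t. t \<ge> 1 \<Longrightarrow> G / sqrt (m t) \<le> \<beta> * (diameter S)\<^sup>2 / (diameter K * (real t + 1))
      \<or> G / sqrt (m t) \<le> 8 * \<beta>\<^sup>2 * diameter K / (\<alpha> * (real t + 1)\<^sup>2)"
    and "t \<ge> 2"
  shows "expectation (gap t) \<le> 4 * (\<beta> * (diameter S)\<^sup>2) / (real t + 1)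
    + 32 * (\<beta>\<^sup>2 * (diameter K)\<^sup>2 / \<alpha>) * (ln (real t) / (real t)\<^sup>2)"
  using \<open>t \<ge> 2\<close>
proof (induction t rule: nat_induct_at_least)
  case base
  let ?C = "\<beta>\<^sup>2 * (diameter K)\<^sup>2 / \<alpha>"
  have "G / sqrt (m 1) \<le> \<beta> * (diameter S)\<^sup>2 / (2 * diameter K)
      \<or> G / sqrt (m 1) \<le> 2 * \<beta>\<^sup>2 * diameter K / \<alpha>"
    using alt[of 1] by (simp add: mult_ac)
  then have "expectation (gap 2) \<le> 4 / 3 * \<beta> * (diameter S)\<^sup>2 + 16 / 3 * ?C"
    using noise[of 1] by (intro expected_first_gap D) auto
  \<comment> \<open>At \<open>t = 2\<close> the coefficient of \<open>?C\<close> in the claim is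
    \<open>32 * ln 2 / 4\<close>, and \<open>ln 2\<close> is at least \<open>2 / 3\<close>.\<close>
  also have "16 / 3 * ?C \<le> 8 * ln 2 * ?C"
    using ln2_ge_two_thirds \<alpha> by (intro mult_right_mono) auto
  finally show ?case by simp
next
  case (Suc t)
  let ?D = "diameter K" and ?d = "diameter S" and ?r = "real t + 1"
  let ?C = "\<beta>\<^sup>2 * ?D\<^sup>2 / \<alpha>"
  have t: "t \<ge> 1" using Suc.hyps by simp
  have C: "?C \<ge> 0" using \<alpha> by simp
  \<comment> \<open>The cruder rate is inserted only into the growth term, which thereby becomes
    cubic in \<open>1 / ?r\<close>.\<close>
  have "2 / \<alpha> * expectation (gap t) \<le> 2 / \<alpha> * (4 * (\<beta> * ?D\<^sup>2) / ?r)"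
    using expected_gap_diameter[OF noise Suc.hyps] \<alpha> by (intro mult_left_mono) auto
  then have "\<beta> * (\<eta> t)\<^sup>2 / 2 * (2 / \<alpha> * expectation (gap t) + ?d\<^sup>2)
      \<le> \<beta> * (\<eta> t)\<^sup>2 / 2 * (2 / \<alpha> * (4 * (\<beta> * ?D\<^sup>2) / ?r) + ?d\<^sup>2)"
    using \<beta> by (intro mult_left_mono) auto
  also have "\<dots> = 2 * (\<beta> * ?d\<^sup>2) * (1 / ?r\<^sup>2) + 16 * ?C * (1 / ?r ^ 3)"
  proof -
    have "\<beta> * (2 / r)\<^sup>2 / 2 * (2 / \<alpha> * (4 * (\<beta> * ?D\<^sup>2) / r) + ?d\<^sup>2)
        = 2 * (\<beta> * ?d\<^sup>2) * (1 / r\<^sup>2) + 16 * ?C * (1 / r ^ 3)" if "r > 0" for r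
      using \<alpha> that by (simp add: power2_eq_square power3_eq_cube field_simps)
    from this[of ?r] show ?thesis by (simp add: \<eta>_def)
  qed
  finally have quadratic: "\<beta> * (\<eta> t)\<^sup>2 / 2 * (2 / \<alpha> * expectation (gap t) + ?d\<^sup>2)
      \<le> 2 * (\<beta> * ?d\<^sup>2) * (1 / ?r\<^sup>2) + 16 * ?C * (1 / ?r ^ 3)" .
  have n: "\<eta> t * (?D * (G / sqrt (m t))) \<le> \<eta> t * (?D * b)" if "G / sqrt (m t) \<le> b" for b
    using \<eta>_bounds[OF t] D that by (intro mult_left_mono) auto
  \<comment> \<open>Under either alternative the noise is at most the bound just found for the
    penalty; the sum of the two gives the constants 4 and 32.\<close>
  have sampling: "\<eta> t * (?D * (G / sqrt (m t)))
      \<le> 2 * (\<beta> * ?d\<^sup>2) * (1 / ?r\<^sup>2) + 16 * ?C * (1 / ?r ^ 3)"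
    using alt[OF t]
  proof
    assume "G / sqrt (m t) \<le> \<beta> * ?d\<^sup>2 / (?D * ?r)"
    from n[OF this] have "\<eta> t * (?D * (G / sqrt (m t))) \<le> 2 * (\<beta> * ?d\<^sup>2) * (1 / ?r\<^sup>2)"
      using D by (simp add: \<eta>_def power2_eq_square)
    moreover have "0 \<le> 16 * ?C * (1 / ?r ^ 3)" using C by (intro mult_nonneg_nonneg) auto
    ultimately show ?thesis by linarith
  next
    assume "G / sqrt (m t) \<le> 8 * \<beta>\<^sup>2 * ?D / (\<alpha> * ?r\<^sup>2)"
    from n[OF this] have "\<eta> t * (?D * (G / sqrt (m t))) \<le> 16 * ?C * (1 / ?r ^ 3)"
      using \<alpha> by (simp add: \<eta>_def power2_eq_square power3_eq_cube mult_ac)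
    moreover have "0 \<le> 2 * (\<beta> * ?d\<^sup>2) * (1 / ?r\<^sup>2)" using \<beta> by (intro mult_nonneg_nonneg) auto
    ultimately show ?thesis by linarith
  qed
  have "(1 - \<eta> t) * expectation (gap t)
    \<le> (1 - \<eta> t) * (4 * (\<beta> * ?d\<^sup>2) / ?r + 32 * ?C * (ln (real t) / (real t)\<^sup>2))"
    using \<eta>_bounds[OF t] Suc.IH by (intro mult_left_mono) auto
  also have "\<dots> = 4 * (\<beta> * ?d\<^sup>2) * ((1 - 2 / ?r) * (1 / ?r))
      + 32 * ?C * ((1 - 2 / ?r) * (ln (real t) / (real t)\<^sup>2))"
    by (simp only: \<eta>_def distrib_left divide_inverse mult_1_left mult_ac)
  finally have "expectation (gap (Suc t))
    \<le> 4 * (\<beta> * ?d\<^sup>2) * ((1 - 2 / ?r) * (1 / ?r) + 1 / ?r\<^sup>2)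
      + 32 * ?C * ((1 - 2 / ?r) * (ln (real t) / (real t)\<^sup>2) + 1 / ?r ^ 3)"
    using expected_gap_step_hull[OF t] quadratic sampling by (simp only: distrib_left)
  also have "\<dots> \<le> 4 * (\<beta> * ?d\<^sup>2) * (1 / (real t + 2)) + 32 * ?C * (ln ?r / ?r\<^sup>2)"
    using t \<beta> C ln_Suc_bound[OF t]
    by (intro add_mono mult_left_mono one_step_arithmetic log_step_arithmetic) auto
  finally show ?case by (simp add: add.commute)
qed

end

section \<open>From batch sizes to noise levels and the convergence rate\<close>

theorem theorem7:
  fixes K S :: "(real ^ 'd) set"
    and f :: "real ^ 'd \<Rightarrow> real"
    and \<alpha> \<beta> G DK Dstar :: real
    and Q :: "real ^ 'd \<Rightarrow> (real ^ 'd) measure"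
    and M :: "'w measure"
    and m :: "nat \<Rightarrow> nat"
    and x v :: "nat \<Rightarrow> 'w \<Rightarrow> real ^ 'd"
    and g :: "nat \<Rightarrow> nat \<Rightarrow> 'w \<Rightarrow> real ^ 'd"
  assumes "convex K" and "compact K"
    and "DK = diameter K" and "DK > 0"
    and "convex_on K f"
    and "\<beta> > 0" and "smooth_over \<beta> f K"
    and "\<alpha> > 0" and "quadratic_growth \<alpha> f K"
    and "optimal_hull_set f K S" and "Dstar = diameter S"
    and "G > 0" and "stochastic_oracle G f K Q"
    and "prob_space M"
    and "stochastic_nep_frank_wolfe M K \<beta> Q (\<lambda>t. 2 / (real t + 1)) m x g v"
    and "\<And>t. t \<ge> 1 \<Longrightarrow>
      real (m t) \<ge> max ((G * (real t + 1) / (\<beta> * DK))\<^sup>2)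
        (if Dstar = 0 then (\<alpha> * G * (real t + 1)\<^sup>2 / (8 * \<beta>\<^sup>2 * DK))\<^sup>2
         else min ((G * DK * (real t + 1) / (\<beta> * Dstar\<^sup>2))\<^sup>2)
                  ((\<alpha> * G * (real t + 1)\<^sup>2 / (8 * \<beta>\<^sup>2 * DK))\<^sup>2))"
  shows "\<forall>t \<ge> 2. (\<integral>\<omega>. f (x t \<omega>) - min_value f K \<partial>M) \<le>
      4 * \<beta> * Dstar\<^sup>2 / (real t + 1) + (32 * \<beta>\<^sup>2 / \<alpha> * DK\<^sup>2 * ln (real t)) / (real t)\<^sup>2"
proof -
  have D: "DK > 0" and \<beta>: "\<beta> > 0" and \<alpha>: "\<alpha> > 0" and G: "G > 0" by fact+
  \<comment> \<open>The first entry of the maximum bounds the noise at every round.\<close>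
  have noise: "G / sqrt (m t) \<le> \<beta> * DK / (real t + 1)" if "t \<ge> 1" for t
    using sqrt_batch_bound[of G "(real t + 1) / (\<beta> * DK)" "m t"] assms(16)[OF that] D \<beta> G by simp
  have alt: "G / sqrt (m t) \<le> \<beta> * Dstar\<^sup>2 / (DK * (real t + 1))
      \<or> G / sqrt (m t) \<le> 8 * \<beta>\<^sup>2 * DK / (\<alpha> * (real t + 1)\<^sup>2)" if "t \<ge> 1" for t
  proof -
    have growth: "G / sqrt (m t) \<le> 8 * \<beta>\<^sup>2 * DK / (\<alpha> * (real t + 1)\<^sup>2)"
      if "real (m t) \<ge> (\<alpha> * G * (real t + 1)\<^sup>2 / (8 * \<beta>\<^sup>2 * DK))\<^sup>2"
      using sqrt_batch_bound[of G "\<alpha> * (real t + 1)\<^sup>2 / (8 * \<beta>\<^sup>2 * DK)" "m t"] that D \<alpha> \<beta> G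
      by (simp add: mult_ac)
    have hull: "G / sqrt (m t) \<le> \<beta> * Dstar\<^sup>2 / (DK * (real t + 1))"
      if "Dstar \<noteq> 0" "real (m t) \<ge> (G * DK * (real t + 1) / (\<beta> * Dstar\<^sup>2))\<^sup>2"
      using sqrt_batch_bound[of G "DK * (real t + 1) / (\<beta> * Dstar\<^sup>2)" "m t"] that D \<beta> G
      by (simp add: mult_ac)
    \<comment> \<open>Exceeding a minimum means exceeding one of its entries; for
      \<open>Dstar = 0\<close> the growth entry is the one given.\<close>
    show ?thesis
      using assms(16)[OF that] growth hull by (auto split: if_splits simp: min_le_iff_disj)
  qed
  \<comment> \<open>The first entry of the maximum is positive, so no batch is empty.\<close>
  have m_pos: "m t > 0" if "t \<ge> 1" for t
  proof -
    have "0 < (G * (real t + 1) / (\<beta> * DK))\<^sup>2" using D \<beta> G by simp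
    also have "\<dots> \<le> real (m t)" using assms(16)[OF that] by simp
    finally show ?thesis by simp
  qed
  interpret prob_space M by fact
  interpret nep_frank_wolfe_run M K S f \<alpha> \<beta> G Q m x v g
    by unfold_locales (use assms m_pos in auto)
  show ?thesis
  proof (intro allI impI)
    fix t :: nat assume "t \<ge> 2"
    then have "expectation (gap t) \<le> 4 * (\<beta> * Dstar\<^sup>2) / (real t + 1)
        + 32 * (\<beta>\<^sup>2 * DK\<^sup>2 / \<alpha>) * (ln (real t) / (real t)\<^sup>2)"
      using expected_gap_bound[of t] noise alt D assms(3,11) by simp
    then show "(\<integral>\<omega>. f (x t \<omega>) - min_value f K \<partial>M)
        \<le> 4 * \<beta> * Dstar\<^sup>2 / (real t + 1) + (32 * \<beta>\<^sup>2 / \<alpha> * DK\<^sup>2 * ln (real t)) / (real t)\<^sup>2"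
      by (simp add: gap_def[abs_def] mult_ac)
  qed
qed

end
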